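(* Let $P_{Y|X}$ be a discrete memoryless channel with finite input alphabet $\mathcal X$ and output alphabet $\mathcal Y$, and let $q:\mathcal X\times\mathcal Y\to\mathbb R$ be a decoding metric. For all finite alphabets $\mathcal X_1,\mathcal X_2$, all distributions $P_{X_1,X_2}$ on $\mathcal X_1\times\mathcal X_2$ and all mappings $\phi:\mathcal X_1\times\mathcal X_2\to\mathcal X$, the mismatch capacity of $P_{Y|X}$ with metric $q$ is at least $\sup\{R_1+R_2:(R_1,R_2)\in\mathcal R_{cog}(P)\}$, where $\mathcal R_{cog}(P)=\mathcal R^{sup}_{cog}(P)\cup\mathcal R^{bin,*}_{cog}(P)$ is computed for the distribution $P=P_{X_1,X_2}P_{Y|X_1,X_2}$ with $P_{Y|X_1,X_2}(y|x_1,x_2)=P_{Y|X}(y|\phi(x_1,x_2))$ and the metric $\tilde q(x_1,x_2,y)=q(\phi(x_1,x_2),y)$.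
   Context: Single-user mismatched decoding: a rate-$R$ code of length $n$ is a set of $2^{nR}$ codewords $\mathbf x(m)\in\mathcal X^n$; messages are uniform; the decoder outputs $m$ iff $\sum_t q(x_t(m),y_t)>\sum_t q(x_t(m'),y_t)$ for all $m'\neq m$, else error. $R$ is achievable if codes exist with average error probability tending to zero; the mismatch capacity is the supremum of achievable rates. For a distribution $Q$ on $\mathcal X_1\times\mathcal X_2\times\mathcal Y$ (with metric $\tilde q$): $\mathcal G(Q)=\{f: f_{X_1,X_2}=Q_{X_1,X_2},\ \mathbb E_f \tilde q(X_1,X_2,Y)\ge\mathbb E_Q\tilde q(X_1,X_2,Y)\}$; $\mathcal L_1(Q)=\{f\in\mathcal G(Q):f_{X_2,Y}=Q_{X_2,Y}\}$; $\mathcal L_2(Q)=\{f\in\mathcal G(Q):f_{X_1,Y}=Q_{X_1,Y}\}$; $\mathcal L_0(Q)=\{f\in\mathcal G(Q):f_Y=Q_Y\}$. $R_1'(P)=\min_{\tilde P\in\mathcal L_1(P)}I_{\tilde P}(X_1;Y,X_2)$; $R_2'(P)=\min_{\tilde P\in\mathcal L_2(P)}I_{\tilde P}(X_2;Y|X_1)$; $R_1''(P,R_2)=\min_{\tilde P\in\mathcal L_0(P)}[I_{\tilde P}(X_1;Y)+|I_{\tilde P}(X_2;Y|X_1)-R_2|^+]$; $R_2''(P,R_1)=\min_{\tilde P\in\mathcal L_0(P)}[I_{\tilde P}(X_2;Y)-I_{\tilde P}(X_2;X_1)+|I_{\tilde P}(X_1;Y,X_2)-R_1|^+]$; $|t|^+=\max\{0,t\}$.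 $\mathcal R^{sup}_{cog}(P)=\{(R_1,R_2):R_2\le R_2'(P),\ R_1\le R_1''(P,R_2)\}$. $\mathcal R^{bin,*}_{cog}(P)$ is the set of $(R_1,R_2)$ for which there exist $R_{1,a},R_{1,b}\ge0$ with $R_1=R_{1,a}+R_{1,b}$, $R_{1,a}\le R_1'(P)$, $R_{1,b}+R_2\le R_2'(P)$, and either $R_{1,a}\le R_1''(P,R_{1,b}+R_2)$ or $R_{1,b}+R_2\le R_2''(P,R_{1,a})$. *)

theory Defs
  imports "HOL-Analysis.Analysis" "HOL-Library.Extended_Real"
begin

definition is_dist :: "('b::finite \<Rightarrow> real) \<Rightarrow> bool" where
  "is_dist p \<longleftrightarrow> (\<forall>x. 0 \<le> p x) \<and> (\<Sum>x\<in>UNIV. p x) = 1"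

definition entropy :: "('b::finite \<Rightarrow> real) \<Rightarrow> real" where
  "entropy p = - (\<Sum>x\<in>UNIV. if p x = 0 then 0 else p x * log 2 (p x))"

type_synonym ('a1, 'a2, 'y) jdist = "'a1 \<times> 'a2 \<times> 'y \<Rightarrow> real"

definition m12 :: "('a1::finite, 'a2::finite, 'y::finite) jdist \<Rightarrow> 'a1 \<times> 'a2 \<Rightarrow> real" where
  "m12 f = (\<lambda>(a, b). \<Sum>y\<in>UNIV. f (a, b, y))"
definition m1y :: "('a1::finite, 'a2::finite, 'y::finite) jdist \<Rightarrow> 'a1 \<times> 'y \<Rightarrow> real" where
  "m1y f = (\<lambda>(a, y). \<Sum>b\<in>UNIV. f (a, b, y))"
definition m2y :: "('a1::finite, 'a2::finite, 'y::finite) jdist \<Rightarrow> 'a2 \<times> 'y \<Rightarrow> real" where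
  "m2y f = (\<lambda>(b, y). \<Sum>a\<in>UNIV. f (a, b, y))"
definition m1 :: "('a1::finite, 'a2::finite, 'y::finite) jdist \<Rightarrow> 'a1 \<Rightarrow> real" where
  "m1 f = (\<lambda>a. \<Sum>(b, y)\<in>UNIV. f (a, b, y))"
definition m2 :: "('a1::finite, 'a2::finite, 'y::finite) jdist \<Rightarrow> 'a2 \<Rightarrow> real" where
  "m2 f = (\<lambda>b. \<Sum>(a, y)\<in>UNIV. f (a, b, y))"
definition my :: "('a1::finite, 'a2::finite, 'y::finite) jdist \<Rightarrow> 'y \<Rightarrow> real" where
  "my f = (\<lambda>y. \<Sum>(a, b)\<in>UNIV. f (a, b, y))"

definition MI_1_Y2 :: "('a1::finite, 'a2::finite, 'y::finite) jdist \<Rightarrow> real" where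
  "MI_1_Y2 f = entropy (m1 f) + entropy (m2y f) - entropy f"
definition MI_2_Y_given_1 :: "('a1::finite, 'a2::finite, 'y::finite) jdist \<Rightarrow> real" where
  "MI_2_Y_given_1 f = entropy (m12 f) + entropy (m1y f) - entropy f - entropy (m1 f)"
definition MI_1_Y :: "('a1::finite, 'a2::finite, 'y::finite) jdist \<Rightarrow> real" where
  "MI_1_Y f = entropy (m1 f) + entropy (my f) - entropy (m1y f)"
definition MI_2_Y :: "('a1::finite, 'a2::finite, 'y::finite) jdist \<Rightarrow> real" where
  "MI_2_Y f = entropy (m2 f) + entropy (my f) - entropy (m2y f)"
definition MI_2_1 :: "('a1::finite, 'a2::finite, 'y::finite) jdist \<Rightarrow> real" where
  "MI_2_1 f = entropy (m1 f) + entropy (m2 f) - entropy (m12 f)"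

definition expect_metric :: "('a1::finite, 'a2::finite, 'y::finite) jdist \<Rightarrow> ('a1 \<Rightarrow> 'a2 \<Rightarrow> 'y \<Rightarrow> real) \<Rightarrow> real" where
  "expect_metric f qt = (\<Sum>(a, b, y)\<in>UNIV. f (a, b, y) * qt a b y)"

definition setG :: "('a1::finite, 'a2::finite, 'y::finite) jdist \<Rightarrow> ('a1 \<Rightarrow> 'a2 \<Rightarrow> 'y \<Rightarrow> real) \<Rightarrow> ('a1, 'a2, 'y) jdist set" where
  "setG Q qt = {f. is_dist f \<and> m12 f = m12 Q \<and> expect_metric f qt \<ge> expect_metric Q qt}"
definition setL1 where "setL1 Q qt = {f \<in> setG Q qt. m2y f = m2y Q}"
definition setL2 where "setL2 Q qt = {f \<in> setG Q qt. m1y f = m1y Q}"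
definition setL0 where "setL0 Q qt = {f \<in> setG Q qt. my f = my Q}"

definition pos_part :: "real \<Rightarrow> real" where "pos_part t = max 0 t"

section \<open>Rate functions (the minima are written as infima over the compact feasible sets)\<close>

definition R1' :: "('a1::finite, 'a2::finite, 'y::finite) jdist \<Rightarrow> ('a1 \<Rightarrow> 'a2 \<Rightarrow> 'y \<Rightarrow> real) \<Rightarrow> real" where
  "R1' P qt = (INF f\<in>setL1 P qt. MI_1_Y2 f)"
definition R2' :: "('a1::finite, 'a2::finite, 'y::finite) jdist \<Rightarrow> ('a1 \<Rightarrow> 'a2 \<Rightarrow> 'y \<Rightarrow> real) \<Rightarrow> real" where
  "R2' P qt = (INF f\<in>setL2 P qt. MI_2_Y_given_1 f)"
definition R1'' :: "('a1::finite, 'a2::finite, 'y::finite) jdist \<Rightarrow> ('a1 \<Rightarrow> 'a2 \<Rightarrow> 'y \<Rightarrow> real) \<Rightarrow> real \<Rightarrow> real" where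
  "R1'' P qt R2 = (INF f\<in>setL0 P qt. MI_1_Y f + pos_part (MI_2_Y_given_1 f - R2))"
definition R2'' :: "('a1::finite, 'a2::finite, 'y::finite) jdist \<Rightarrow> ('a1 \<Rightarrow> 'a2 \<Rightarrow> 'y \<Rightarrow> real) \<Rightarrow> real \<Rightarrow> real" where
  "R2'' P qt R1 = (INF f\<in>setL0 P qt. MI_2_Y f - MI_2_1 f + pos_part (MI_1_Y2 f - R1))"

definition R_sup_cog :: "('a1::finite, 'a2::finite, 'y::finite) jdist \<Rightarrow> ('a1 \<Rightarrow> 'a2 \<Rightarrow> 'y \<Rightarrow> real) \<Rightarrow> (real \<times> real) set" where
  "R_sup_cog P qt = {(R1, R2). 0 \<le> R1 \<and> 0 \<le> R2 \<and> R2 \<le> R2' P qt \<and> R1 \<le> R1'' P qt R2}"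

definition R_bin_cog :: "('a1::finite, 'a2::finite, 'y::finite) jdist \<Rightarrow> ('a1 \<Rightarrow> 'a2 \<Rightarrow> 'y \<Rightarrow> real) \<Rightarrow> (real \<times> real) set" where
  "R_bin_cog P qt = {(R1, R2). 0 \<le> R1 \<and> 0 \<le> R2 \<and>
     (\<exists>R1a R1b. 0 \<le> R1a \<and> 0 \<le> R1b \<and> R1 = R1a + R1b \<and> R1a \<le> R1' P qt \<and>
        R1b + R2 \<le> R2' P qt \<and>
        (R1a \<le> R1'' P qt (R1b + R2) \<or> R1b + R2 \<le> R2'' P qt R1a))}"

definition R_cog where "R_cog P qt = R_sup_cog P qt \<union> R_bin_cog P qt"

definition is_channel :: "('x::finite \<Rightarrow> 'y::finite \<Rightarrow> real) \<Rightarrow> bool" where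
  "is_channel W \<longleftrightarrow> (\<forall>x. is_dist (W x))"

text \<open>A code of length n with M codewords: C m t is the t-th symbol of codeword m (m < M, t < n).
  The mismatched decoder outputs m iff its metric strictly exceeds that of every other codeword.\<close>
definition decodes_correctly ::
  "('x \<Rightarrow> 'y \<Rightarrow> real) \<Rightarrow> nat \<Rightarrow> nat \<Rightarrow> (nat \<Rightarrow> nat \<Rightarrow> 'x) \<Rightarrow> nat \<Rightarrow> (nat \<Rightarrow> 'y) \<Rightarrow> bool" where
  "decodes_correctly q n M C m y \<longleftrightarrow>
     (\<forall>m'<M. m' \<noteq> m \<longrightarrow> (\<Sum>t<n. q (C m' t) (y t)) < (\<Sum>t<n. q (C m t) (y t)))"

definition avg_error_prob ::
  "('x::finite \<Rightarrow> 'y::finite \<Rightarrow> real) \<Rightarrow> ('x \<Rightarrow> 'y \<Rightarrow> real) \<Rightarrow> nat \<Rightarrow> nat \<Rightarrow> (nat \<Rightarrow> nat \<Rightarrow> 'x) \<Rightarrow> real" where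
  "avg_error_prob W q n M C = (1 / real M) * (\<Sum>m<M. \<Sum>y\<in>{..<n} \<rightarrow>\<^sub>E (UNIV :: 'y set).
      (\<Prod>t<n. W (C m t) (y t)) * (if decodes_correctly q n M C m y then 0 else 1))"

definition num_msgs :: "real \<Rightarrow> nat \<Rightarrow> nat" where
  "num_msgs R n = nat \<lceil>2 powr (real n * R)\<rceil>"

definition achievable :: "('x::finite \<Rightarrow> 'y::finite \<Rightarrow> real) \<Rightarrow> ('x \<Rightarrow> 'y \<Rightarrow> real) \<Rightarrow> real \<Rightarrow> bool" where
  "achievable W q R \<longleftrightarrow> (\<exists>C :: nat \<Rightarrow> nat \<Rightarrow> nat \<Rightarrow> 'x.
      (\<lambda>n. avg_error_prob W q n (num_msgs R n) (C n)) \<longlonglongrightarrow> 0)"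

definition mismatch_capacity :: "('x::finite \<Rightarrow> 'y::finite \<Rightarrow> real) \<Rightarrow> ('x \<Rightarrow> 'y \<Rightarrow> real) \<Rightarrow> ereal" where
  "mismatch_capacity W q = Sup (ereal ` {R. achievable W q R})"

definition induced_dist ::
  "('a1 \<times> 'a2 \<Rightarrow> real) \<Rightarrow> ('x \<Rightarrow> 'y \<Rightarrow> real) \<Rightarrow> ('a1 \<Rightarrow> 'a2 \<Rightarrow> 'x) \<Rightarrow> ('a1, 'a2, 'y) jdist" where
  "induced_dist PX W \<phi> = (\<lambda>(a, b, y). PX (a, b) * W (\<phi> a b) y)"

definition induced_metric :: "('x \<Rightarrow> 'y \<Rightarrow> real) \<Rightarrow> ('a1 \<Rightarrow> 'a2 \<Rightarrow> 'x) \<Rightarrow> 'a1 \<Rightarrow> 'a2 \<Rightarrow> 'y \<Rightarrow> real" where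
  "induced_metric q \<phi> = (\<lambda>a b y. q (\<phi> a b) y)"

end

theory Submission
  imports Defs "HOL-Real_Asymp.Real_Asymp"
begin

text \<open>
  Superposition coding suffices: the binning region never beats it in sum rate.
  If \<open>R1a \<le> R1''(P, R1b + R2)\<close> holds, then \<open>(R1a, R1b + R2)\<close> already lies in the superposition region.
  If \<open>R1b + R2 \<le> R2''(P, R1a)\<close> holds, exchange the two auxiliary alphabets: with
  \<open>I = I(X1;X2)\<close>, the pair \<open>(R1b + R2 + I, R1a - I)\<close> lies in the exchanged superposition region, because
  \<open>I(X1;Y,X2) = I + I(X1;Y|X2)\<close>; when \<open>R1a < I\<close> the pair \<open>(R1a + R1b + R2, 0)\<close> does.

  For superposition coding, cloud centres and satellites are drawn from the product distributions
  conditioned on joint typicality (in the \<open>L1\<close> sense), which costs only a constant factor in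
  probability and needs no approximation of \<open>P\<close> by types of denominator \<open>n\<close>. Gibbs' inequality
  bounds the probability that a competing codeword has joint type \<open>f\<close> with the output by
  \<open>2^(- n I\<^sub>f)\<close>, and compactness of the simplex passes from types near the marginals of \<open>P\<close> to the
  sets \<open>L0\<close> and \<open>L2\<close>. The term \<open>|I - R2|\<^sup>+\<close> comes from truncating the union bound over each
  competing cloud at 1.
\<close>

section \<open>Marginals, entropy and types\<close>

text \<open>Conditioning on joint typicality is needed because every \<open>f\<close> in
  \<open>setG\<close> has the \<open>X1\<close>, \<open>X2\<close> marginal of \<open>P\<close>:
  under the plain product law a competing pair could have another joint type, over which the rate
  functions say nothing. All estimates at fixed \<open>n\<close> are explicit and hold for a
  tolerance \<open>\<eta>\<close>; the limit is taken only at the end. The exponents beat the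
  polynomial number of types only if each rate lies strictly below its bound. That is arranged by
  scaling both rates down, which gains nothing for a rate equal to 0. Therefore the error bounds
  carry factors (number of messages minus one), which vanish exactly at rate 0. The exchange of the
  auxiliary alphabets costs nothing on the channel side: the code sees only the symbols
  \<open>\<phi> a b\<close>, so the exchanged problem is again induced by the same channel and
  metric.\<close>

definition marg :: "('c::finite \<Rightarrow> 'd::finite) \<Rightarrow> ('c \<Rightarrow> real) \<Rightarrow> 'd \<Rightarrow> real" where
  "marg \<pi> f v = (\<Sum>z | \<pi> z = v. f z)"

lemma sum_marg: "(\<Sum>v\<in>UNIV. marg \<pi> f v * h v) = (\<Sum>z\<in>UNIV. f z * h (\<pi> z))"
proof -
  have "(\<Sum>v\<in>UNIV. marg \<pi> f v * h v) = (\<Sum>v\<in>UNIV. \<Sum>z | \<pi> z = v. f z * h (\<pi> z))"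
    unfolding marg_def sum_distrib_right by (intro sum.cong) auto
  also have "\<dots> = (\<Sum>z\<in>UNIV. f z * h (\<pi> z))"
    using sum.group[of UNIV UNIV \<pi> "\<lambda>z. f z * h (\<pi> z)"] by simp
  finally show ?thesis .
qed

lemma is_dist_marg: "is_dist f \<Longrightarrow> is_dist (marg \<pi> f)"
  using sum_marg[of \<pi> f "\<lambda>_. 1"] by (auto simp: is_dist_def marg_def intro!: sum_nonneg)

lemma is_dist_nonneg: "is_dist f \<Longrightarrow> 0 \<le> f z"
  by (simp add: is_dist_def)

lemma le_marg: "is_dist f \<Longrightarrow> f z \<le> marg \<pi> f (\<pi> z)"
  unfolding marg_def by (rule member_le_sum) (auto simp: is_dist_def)

lemma marg_pos: "is_dist f \<Longrightarrow> 0 < f z \<Longrightarrow> 0 < marg \<pi> f (\<pi> z)"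
  using le_marg[of f z \<pi>] by linarith

lemma entropy_alt: "entropy p = - (\<Sum>x\<in>UNIV. p x * log 2 (p x))"
  unfolding entropy_def by (intro arg_cong[where f = uminus] sum.cong) auto

lemma entropy_marg: "entropy (marg \<pi> f) = - (\<Sum>z\<in>UNIV. f z * log 2 (marg \<pi> f (\<pi> z)))"
  unfolding entropy_alt sum_marg ..

lemma entropy_unit: "is_dist (p :: unit \<Rightarrow> real) \<Longrightarrow> entropy p = 0"
  by (simp add: is_dist_def entropy_alt UNIV_unit)

text \<open>Nonnegativity of a conditional divergence: the right side is minus the entropy of
  \<open>z\<close> given \<open>\<pi> z\<close>, and \<open>k\<close> is a substochastic kernel on
  the fibres of \<open>\<pi>\<close>. Mass below 1 is allowed because conditional laws computed as
  quotients vanish on fibres of marginal mass 0. Suitable choices of \<open>k\<close> give both the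
  probability bounds for codewords and the nonnegativity of mutual information.\<close>

lemma gibbs:
  assumes f: "is_dist f" and k0: "\<And>z. 0 \<le> k z"
    and k1: "\<And>v. (\<Sum>z | \<pi> z = v. k z) \<le> 1"
    and pos: "\<And>z. 0 < f z \<Longrightarrow> 0 < k z"
  shows "(\<Sum>z\<in>UNIV. f z * log 2 (k z)) \<le> entropy (marg \<pi> f) - entropy f"
proof -
  let ?g = "\<lambda>z. marg \<pi> f (\<pi> z)"
  have 1: "f z * log 2 (k z) + f z * log 2 (?g z) - f z * log 2 (f z) \<le> (k z * ?g z - f z) / ln 2" for z
  proof (cases "f z = 0")
    case True
    have "0 \<le> ?g z" using is_dist_nonneg[OF is_dist_marg[OF f]] .
    then show ?thesis using True k0[of z] by simp
  next
    case False
    then have fz: "0 < f z" using is_dist_nonneg[OF f, of z] by linarith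
    have kz: "0 < k z" and gz: "0 < ?g z" using pos[OF fz] marg_pos[OF f fz] by auto
    have "ln (k z) + ln (?g z) - ln (f z) = ln (k z * ?g z / f z)"
      using fz kz gz by (simp add: ln_mult ln_div)
    also have "\<dots> \<le> k z * ?g z / f z - 1"
      using fz kz gz by (intro ln_le_minus_one) simp
    finally have "f z * (ln (k z) + ln (?g z) - ln (f z)) \<le> f z * (k z * ?g z / f z - 1)"
      using fz by (intro mult_left_mono) auto
    also have "\<dots> = k z * ?g z - f z" using fz by (simp add: field_simps)
    finally have "f z * (ln (k z) + ln (?g z) - ln (f z)) / ln 2 \<le> (k z * ?g z - f z) / ln 2"
      by (intro divide_right_mono) auto
    moreover have "f z * log 2 (k z) + f z * log 2 (?g z) - f z * log 2 (f z) =
        f z * (ln (k z) + ln (?g z) - ln (f z)) / ln 2"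
      by (simp add: log_def algebra_simps add_divide_distrib diff_divide_distrib)
    ultimately show ?thesis by simp
  qed
  have "(\<Sum>z\<in>UNIV. f z * log 2 (k z)) - (entropy (marg \<pi> f) - entropy f) =
      (\<Sum>z\<in>UNIV. f z * log 2 (k z) + f z * log 2 (?g z) - f z * log 2 (f z))"
    unfolding entropy_marg entropy_alt[of f] sum.distrib sum_subtractf by simp
  also have "\<dots> \<le> (\<Sum>z\<in>UNIV. (k z * ?g z - f z) / ln 2)"
    by (intro sum_mono 1)
  also have "\<dots> = ((\<Sum>z\<in>UNIV. k z * ?g z) - 1) / ln 2"
    using f by (simp add: sum_divide_distrib[symmetric] sum_subtractf is_dist_def)
  also have "(\<Sum>z\<in>UNIV. k z * ?g z) = (\<Sum>v\<in>UNIV. marg \<pi> k v * marg \<pi> f v)"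
    unfolding sum_marg ..
  also have "\<dots> \<le> (\<Sum>v\<in>UNIV. 1 * marg \<pi> f v)"
    using k1 is_dist_nonneg[OF is_dist_marg[OF f]] by (intro sum_mono mult_right_mono) (auto simp: marg_def)
  also have "\<dots> = 1" using is_dist_marg[OF f, of \<pi>] by (simp add: is_dist_def)
  finally show ?thesis by (simp add: divide_right_mono)
qed

text \<open>Equality case of \<open>gibbs\<close>: the kernel is the conditional law of
  \<open>f\<close> itself.\<close>

lemma cond_entropy_eq:
  assumes f: "is_dist f"
  shows "(\<Sum>z\<in>UNIV. f z * log 2 (f z / marg \<pi> f (\<pi> z))) = entropy (marg \<pi> f) - entropy f"
proof -
  have "f z * log 2 (f z / marg \<pi> f (\<pi> z)) = f z * log 2 (f z) - f z * log 2 (marg \<pi> f (\<pi> z))" for z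
    using marg_pos[OF f, of z \<pi>] is_dist_nonneg[OF f, of z]
    by (cases "f z = 0") (auto simp: log_divide algebra_simps)
  then show ?thesis unfolding entropy_marg entropy_alt[of f] by (simp add: sum_subtractf)
qed

text \<open>Not an equation, because a fibre of marginal mass 0 contributes 0 by
  \<open>x / 0 = 0\<close>.\<close>

lemma cond_sum_le_1:
  assumes f: "is_dist f"
  shows "(\<Sum>z | \<pi> z = v. f z / marg \<pi> f (\<pi> z)) \<le> 1"
proof -
  have "(\<Sum>z | \<pi> z = v. f z / marg \<pi> f (\<pi> z)) = marg \<pi> f v / marg \<pi> f v"
    unfolding marg_def[of \<pi> f v] sum_divide_distrib by (intro sum.cong) (auto simp: marg_def)
  then show ?thesis by simp
qed

section \<open>Empirical distributions and the method of types\<close>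

definition emp :: "nat \<Rightarrow> (nat \<Rightarrow> 'c) \<Rightarrow> 'c \<Rightarrow> real" where
  "emp n z c = (\<Sum>t<n. of_bool (z t = c)) / real n"

lemma sum_emp: "(\<Sum>c\<in>UNIV. emp n z c * h c) = (\<Sum>t<n. h (z t :: 'c::finite)) / real n"
proof -
  have "(\<Sum>c\<in>UNIV. emp n z c * h c) = (\<Sum>c\<in>UNIV. \<Sum>t<n. of_bool (z t = c) * h c) / real n"
    unfolding emp_def sum_divide_distrib sum_distrib_right by simp
  also have "\<dots> = (\<Sum>t<n. \<Sum>c\<in>UNIV. of_bool (z t = c) * h c) / real n"
    by (subst sum.swap) (rule refl)
  also have "(\<lambda>t. \<Sum>c\<in>UNIV. of_bool (z t = c) * h c) = (\<lambda>t. h (z t))"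
    by (auto simp: fun_eq_iff of_bool_def if_distrib[of "\<lambda>x. x * _"] cong: if_cong)
  finally show ?thesis .
qed

lemma emp_nonneg: "0 \<le> emp n z c"
  by (auto simp: emp_def intro!: sum_nonneg divide_nonneg_nonneg)

lemma is_dist_emp: "0 < n \<Longrightarrow> is_dist (emp n (z :: nat \<Rightarrow> 'c::finite))"
  using sum_emp[of n z "\<lambda>_. 1"] by (auto simp: is_dist_def emp_nonneg)

lemma emp_cong: "(\<And>t. t < n \<Longrightarrow> z t = z' t) \<Longrightarrow> emp n z = emp n z'"
  by (auto simp: emp_def fun_eq_iff)

lemma emp_pos: "t < n \<Longrightarrow> 0 < emp n z (z t)"
proof -
  assume t: "t < n"
  have "(1::real) = of_bool (z t = z t)" by simp
  also have "\<dots> \<le> (\<Sum>s<n. of_bool (z s = z t))" using t by (intro member_le_sum) auto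
  finally show ?thesis using t unfolding emp_def by (intro divide_pos_pos) auto
qed

lemma emp_posD:
  assumes "0 < emp n z c" obtains t where "t < n" "z t = c"
proof (cases "\<exists>t<n. z t = c")
  case False
  then have "emp n z c = 0" by (simp add: emp_def)
  then show ?thesis using assms by simp
qed (use that in blast)

lemma marg_emp: "marg \<pi> (emp n z) = emp n (\<lambda>t. \<pi> (z t))"
proof
  fix v
  have "marg \<pi> (emp n z) v = (\<Sum>u\<in>UNIV. marg \<pi> (emp n z) u * of_bool (u = v))"
    by (simp add: of_bool_def if_distrib[of "\<lambda>x. _ * x"] cong: if_cong)
  also have "\<dots> = (\<Sum>t<n. of_bool (\<pi> (z t) = v)) / real n"
    unfolding sum_marg sum_emp ..
  finally show "marg \<pi> (emp n z) v = emp n (\<lambda>t. \<pi> (z t)) v" by (simp add: emp_def)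
qed

lemma prod_emp:
  assumes "\<And>t. t < n \<Longrightarrow> 0 < k (z t :: 'c::finite)"
  shows "(\<Prod>t<n. k (z t)) = 2 powr (real n * (\<Sum>c\<in>UNIV. emp n z c * log 2 (k c)))"
proof (cases "n = 0")
  case False
  have "2 powr (\<Sum>t<n. log 2 (k (z t))) = (\<Prod>t<n. 2 powr log 2 (k (z t)))"
    by (simp add: powr_sum)
  also have "\<dots> = (\<Prod>t<n. k (z t))" using assms by (intro prod.cong) auto
  finally show ?thesis using False by (simp add: sum_emp)
qed simp

text \<open>No memoryless kernel gives a sequence more probability than the conditional law read off
  from the sequence's own type does; this is \<open>gibbs\<close> in the exponent. The bound is
  therefore valid for atypical sequences as well.\<close>

lemma prod_kernel_le:
  assumes k0: "\<And>z. 0 \<le> k z" and k1: "\<And>v. (\<Sum>z | \<pi> z = v. k z) \<le> 1" and n: "0 < n"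
  shows "(\<Prod>t<n. k (z t)) \<le> 2 powr (- (real n * (entropy (emp n z) - entropy (emp n (\<lambda>t. \<pi> (z t))))))"
proof (cases "\<exists>t<n. k (z t) = 0")
  case True
  then have "(\<Prod>t<n. k (z t)) = 0" by (intro prod_zero) auto
  then show ?thesis by (simp only: powr_ge_zero)
next
  case False
  then have pos: "0 < k (z t)" if "t < n" for t using k0[of "z t"] that by (metis less_eq_real_def)
  have h: "(\<Sum>c\<in>UNIV. emp n z c * log 2 (k c)) \<le> entropy (marg \<pi> (emp n z)) - entropy (emp n z)"
    by (rule gibbs[OF is_dist_emp[OF n] k0 k1]) (auto elim!: emp_posD intro: pos)
  have "real n * (\<Sum>c\<in>UNIV. emp n z c * log 2 (k c)) \<le> - (real n * (entropy (emp n z) - entropy (emp n (\<lambda>t. \<pi> (z t)))))"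
    using mult_left_mono[OF h, of "real n"]
    unfolding marg_emp by (simp add: right_diff_distrib)
  then show ?thesis by (subst prod_emp[of n k z, OF pos]) auto
qed

text \<open>Size of a conditional type class: \<open>\<iota>\<close> places an entry of
  \<open>u\<close> beside the fixed \<open>w\<close>, and \<open>\<pi>\<close> reads
  \<open>w\<close> back. Under the conditional law of \<open>f\<close> given \<open>\<pi>\<close>,
  all counted sequences have the same probability, and these probabilities sum to at most 1. A
  general \<open>\<iota>\<close> is used because a satellite symbol sits in the middle of its
  triple.\<close>

lemma card_type_le:
  fixes \<iota> :: "'u::finite \<Rightarrow> 'w::finite \<Rightarrow> 'z::finite"
  assumes \<iota>: "\<And>u w. \<pi> (\<iota> u w) = w" "\<And>u u' w. \<iota> u w = \<iota> u' w \<Longrightarrow> u = u'" and n: "0 < n"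
  shows "real (card {u \<in> {..<n} \<rightarrow>\<^sub>E UNIV. emp n (\<lambda>t. \<iota> (u t) (w t)) = f})
      \<le> 2 powr (real n * (entropy f - entropy (marg \<pi> f)))"
proof -
  let ?U = "{u \<in> {..<n} \<rightarrow>\<^sub>E UNIV. emp n (\<lambda>t. \<iota> (u t) (w t)) = f}"
  show ?thesis
  proof (cases "?U = {}")
    case True
    then show ?thesis by (metis card.empty of_nat_0 powr_ge_zero)
  next
    case False
    \<comment> \<open>The function \<open>f\<close> is arbitrary; only the existence of a sequence
      of this type makes it a distribution.\<close>
    then have f: "is_dist f" using is_dist_emp[OF n] by blast
    define k where "k z = f z / marg \<pi> f (\<pi> z)" for z
    have k0: "0 \<le> k z" for z
      using is_dist_nonneg[OF f] is_dist_nonneg[OF is_dist_marg[OF f], of \<pi>] by (simp add: k_def)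
    let ?E = "2 powr (real n * (entropy (marg \<pi> f) - entropy f))"
    have eq: "(\<Prod>t<n. k (\<iota> (u t) (w t))) = ?E" if "u \<in> ?U" for u
    proof -
      let ?z = "\<lambda>t. \<iota> (u t) (w t)"
      have ez: "emp n ?z = f" using that by simp
      have "0 < k (?z t)" if "t < n" for t
      proof -
        have "0 < f (?z t)" using emp_pos[OF that, of ?z] unfolding ez .
        then show ?thesis using marg_pos[OF f, of "?z t" \<pi>] unfolding k_def by simp
      qed
      then have "(\<Prod>t<n. k (?z t)) = 2 powr (real n * (\<Sum>c\<in>UNIV. f c * log 2 (k c)))"
        by (subst prod_emp) (auto simp: ez)
      then show ?thesis unfolding k_def cond_entropy_eq[OF f] .
    qed
    have fin: "finite ({..<n} \<rightarrow>\<^sub>E (UNIV :: 'u set))" by (intro finite_PiE) auto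
    have "real (card ?U) * ?E = (\<Sum>u\<in>?U. \<Prod>t<n. k (\<iota> (u t) (w t)))"
      by (simp add: eq)
    also have "\<dots> \<le> (\<Sum>u\<in>{..<n} \<rightarrow>\<^sub>E UNIV. \<Prod>t<n. k (\<iota> (u t) (w t)))"
      by (intro sum_mono2 fin) (auto intro!: prod_nonneg k0)
    also have "\<dots> = (\<Prod>t<n. \<Sum>u\<in>UNIV. k (\<iota> u (w t)))"
      by (subst prod_sum_PiE) auto
    also have "\<dots> \<le> 1"
    proof (intro prod_le_1 conjI sum_nonneg k0)
      fix t
      have inj: "inj (\<lambda>u. \<iota> u (w t))" by (intro injI) (rule \<iota>(2))
      have "(\<Sum>u\<in>UNIV. k (\<iota> u (w t))) = sum k (range (\<lambda>u. \<iota> u (w t)))"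
        by (subst sum.reindex[OF inj]) simp
      also have "\<dots> \<le> sum k {z. \<pi> z = w t}"
        by (intro sum_mono2) (auto simp: \<iota> k0)
      also have "\<dots> \<le> 1" unfolding k_def by (rule cond_sum_le_1[OF f])
      finally show "(\<Sum>u\<in>UNIV. k (\<iota> u (w t))) \<le> 1" .
    qed
    finally have "real (card ?U) \<le> 1 / ?E" by (simp add: field_simps)
    also have "\<dots> = 2 powr (real n * (entropy f - entropy (marg \<pi> f)))"
      by (simp add: powr_minus_divide[symmetric] algebra_simps)
    finally show ?thesis .
  qed
qed

lemma range_emp:
  "finite (range (emp n :: (nat \<Rightarrow> 'c::finite) \<Rightarrow> _))"
  "card (range (emp n :: (nat \<Rightarrow> 'c) \<Rightarrow> _)) \<le> (n + 1) ^ CARD('c)"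
proof -
  let ?B = "(\<lambda>k. real k / real n) ` {..n}"
  have "emp n z c \<in> ?B" for z :: "nat \<Rightarrow> 'c" and c
  proof -
    have "(\<Sum>t<n. of_bool (z t = c)) = real (card {t\<in>{..<n}. z t = c})"
      by (simp add: of_bool_def sum.If_cases Int_def)
    moreover have "card {t\<in>{..<n}. z t = c} \<le> n"
      using card_mono[of "{..<n}" "{t\<in>{..<n}. z t = c}"] by auto
    ultimately show ?thesis unfolding emp_def by (intro image_eqI) auto
  qed
  then have sub: "range (emp n :: (nat \<Rightarrow> 'c) \<Rightarrow> _) \<subseteq> UNIV \<rightarrow>\<^sub>E ?B" by auto
  have fin: "finite ((UNIV :: 'c set) \<rightarrow>\<^sub>E ?B)" by (intro finite_PiE) auto
  show "finite (range (emp n :: (nat \<Rightarrow> 'c) \<Rightarrow> _))" using finite_subset[OF sub fin] .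
  have "card (range (emp n :: (nat \<Rightarrow> 'c) \<Rightarrow> _)) \<le> card ((UNIV :: 'c set) \<rightarrow>\<^sub>E ?B)"
    by (rule card_mono[OF fin sub])
  also have "\<dots> = card ?B ^ CARD('c)" by (simp add: card_PiE)
  also have "\<dots> \<le> (n + 1) ^ CARD('c)"
    using card_image_le[of "{..n}" "\<lambda>k. real k / real n"] by (intro power_mono) auto
  finally show "card (range (emp n :: (nat \<Rightarrow> 'c) \<Rightarrow> _)) \<le> (n + 1) ^ CARD('c)" .
qed

section \<open>Mutual information, compactness and exchange of the auxiliary alphabets\<close>

text \<open>Once all marginals are push-forwards, facts on entropy, continuity and \<open>l1\<close>
  distance are proved for \<open>marg\<close> alone.\<close>

lemma marginals:
  fixes f :: "('a::finite, 'b::finite, 'c::finite) jdist"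
  shows
  "m12 f = marg (\<lambda>(a, b, y). (a, b)) f"
  "m1y f = marg (\<lambda>(a, b, y). (a, y)) f"
  "m2y f = marg (\<lambda>(a, b, y). (b, y)) f"
  "m1 f = marg (\<lambda>(a, b, y). a) f"
  "m2 f = marg (\<lambda>(a, b, y). b) f"
  "my f = marg (\<lambda>(a, b, y). y) f"
proof -
  have "{z :: 'a \<times> 'b \<times> 'c. (case z of (a', b', y') \<Rightarrow> (a', b')) = (a, b)} = range (\<lambda>y. (a, b, y))"
    for a :: 'a and b :: 'b by auto
  then show "m12 f = marg (\<lambda>(a, b, y). (a, b)) f"
    by (auto simp: fun_eq_iff m12_def marg_def sum.reindex inj_on_def)
  have "{z :: 'a \<times> 'b \<times> 'c. (case z of (a', b', y') \<Rightarrow> (a', y')) = (a, y)} = range (\<lambda>b. (a, b, y))"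
    for a :: 'a and y :: 'c by auto
  then show "m1y f = marg (\<lambda>(a, b, y). (a, y)) f"
    by (auto simp: fun_eq_iff m1y_def marg_def sum.reindex inj_on_def)
  have eq: "{z :: 'a \<times> 'b \<times> 'c. (case z of (a', b', y') \<Rightarrow> (b', y')) = (b, y)} = range (\<lambda>a. (a, b, y))"
    for b :: 'b and y :: 'c by auto
  have "m2y f (b, y) = marg (\<lambda>(a, b, y). (b, y)) f (b, y)" for b y
    by (simp only: eq marg_def m2y_def split_conv) (simp add: sum.reindex inj_on_def)
  then show "m2y f = marg (\<lambda>(a, b, y). (b, y)) f"
    by (intro ext) (metis surj_pair)
  have "{z :: 'a \<times> 'b \<times> 'c. (case z of (a', b', y') \<Rightarrow> a') = a} = range (\<lambda>(b, y). (a, b, y))" for a :: 'a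
    by (auto simp: image_iff)
  then show "m1 f = marg (\<lambda>(a, b, y). a) f"
    by (auto simp: fun_eq_iff m1_def marg_def sum.reindex inj_on_def case_prod_unfold)
  have "{z :: 'a \<times> 'b \<times> 'c. (case z of (a', b', y') \<Rightarrow> b') = b} = range (\<lambda>(a, y). (a, b, y))" for b :: 'b
    by (auto simp: image_iff)
  then show "m2 f = marg (\<lambda>(a, b, y). b) f"
    by (auto simp: fun_eq_iff m2_def marg_def sum.reindex inj_on_def case_prod_unfold)
  have "{z :: 'a \<times> 'b \<times> 'c. (case z of (a', b', y') \<Rightarrow> y') = y} = range (\<lambda>(a, b). (a, b, y))" for y :: 'c
    by (auto simp: image_iff)
  then show "my f = marg (\<lambda>(a, b, y). y) f"
    by (auto simp: fun_eq_iff my_def marg_def sum.reindex inj_on_def case_prod_unfold)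
qed

lemma marg_marg: "marg \<rho> (marg \<pi> f) = marg (\<lambda>z. \<rho> (\<pi> z)) f"
proof
  fix v
  have "marg \<rho> (marg \<pi> f) v = (\<Sum>u\<in>UNIV. marg \<pi> f u * of_bool (\<rho> u = v))"
    by (simp add: marg_def[of \<rho>] of_bool_def if_distrib[of "\<lambda>x. _ * x"] sum.If_cases cong: if_cong)
  also have "\<dots> = marg (\<lambda>z. \<rho> (\<pi> z)) f v"
    unfolding sum_marg
    by (simp add: marg_def of_bool_def if_distrib[of "\<lambda>x. _ * x"] sum.If_cases cong: if_cong)
  finally show "marg \<rho> (marg \<pi> f) v = marg (\<lambda>z. \<rho> (\<pi> z)) f v" .
qed

text \<open>\<open>gibbs\<close> with the law of \<open>X2\<close> given \<open>X1\<close> as the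
  kernel on the fibres over (\<open>X1\<close>, \<open>Y\<close>). Applied to an exchanged
  distribution, it yields I(X1;X2) \<le> I(X1;Y,X2).\<close>

lemma MI_2_Y_given_1_nonneg:
  fixes f :: "('a::finite, 'b::finite, 'c::finite) jdist"
  assumes f: "is_dist f"
  shows "0 \<le> MI_2_Y_given_1 f"
proof -
  let ?p = "\<lambda>(a :: 'a, b :: 'b, y :: 'c). (a, b)" and ?q = "\<lambda>(a :: 'a, b :: 'b, y :: 'c). (a, y)"
  define k where "k z = marg ?p f (?p z) / marg fst (marg ?p f) (fst (?p z))" for z
  have d: "is_dist (marg ?p f)" by (rule is_dist_marg[OF f])
  have m1: "marg fst (marg ?p f) = m1 f"
    by (simp add: marg_marg marginals case_prod_unfold)
  have "(\<Sum>z\<in>UNIV. f z * log 2 (k z)) \<le> entropy (marg ?q f) - entropy f"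
  proof (rule gibbs[OF f])
    show "0 \<le> k z" for z
      using is_dist_nonneg[OF d] is_dist_nonneg[OF is_dist_marg[OF d, of fst]]
      by (simp add: k_def)
    show "(\<Sum>z | ?q z = v. k z) \<le> 1" for v
    proof -
      obtain a y where v: "v = (a, y)" by (cases v)
      have "{z. ?q z = v} = range (\<lambda>b. (a, b, y))" by (auto simp: v)
      then have "(\<Sum>z | ?q z = v. k z) = (\<Sum>b\<in>UNIV. k (a, b, y))"
        by (simp add: sum.reindex inj_on_def)
      also have "\<dots> = (\<Sum>b\<in>UNIV. marg ?p f (a, b) / marg fst (marg ?p f) (fst (a, b)))"
        by (simp add: k_def)
      also have "\<dots> = (\<Sum>z\<in>range (Pair a). marg ?p f z / marg fst (marg ?p f) (fst z))"
        by (simp add: sum.reindex inj_on_def)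
      also have "range (Pair a) = {z. fst z = a}" by auto
      also have "(\<Sum>z | fst z = a. marg ?p f z / marg fst (marg ?p f) (fst z)) \<le> 1"
        by (rule cond_sum_le_1[OF d])
      finally show ?thesis .
    qed
    show "0 < k z" if "0 < f z" for z
      using marg_pos[OF f that, of ?p] marg_pos[OF d marg_pos[OF f that], of fst]
      by (simp add: k_def)
  qed
  moreover have "(\<Sum>z\<in>UNIV. f z * log 2 (k z)) = entropy (m1 f) - entropy (marg ?p f)"
    unfolding k_def m1[symmetric] cond_entropy_eq[OF d, of fst, symmetric]
    using sum_marg[of ?p f "\<lambda>u. log 2 (marg ?p f u / marg fst (marg ?p f) (fst u))"] by simp
  ultimately show ?thesis by (simp add: MI_2_Y_given_1_def marginals)
qed

text \<open>\<open>gibbs\<close> again: the kernel is the marginal of \<open>X2\<close>, on the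
  fibres of the first coordinate.\<close>

lemma MI_2_1_nonneg:
  fixes f :: "('a::finite, 'b::finite, 'c::finite) jdist"
  assumes f: "is_dist f"
  shows "0 \<le> MI_2_1 f"
proof -
  have d: "is_dist (m12 f)" "is_dist (m2 f)" by (auto simp: marginals is_dist_marg[OF f])
  have m: "marg fst (m12 f) = m1 f" "marg snd (m12 f) = m2 f"
    by (simp_all add: marg_marg marginals case_prod_unfold)
  have "(\<Sum>z\<in>UNIV. m12 f z * log 2 (m2 f (snd z))) \<le> entropy (marg fst (m12 f)) - entropy (m12 f)"
  proof (rule gibbs[OF d(1)])
    show "0 \<le> m2 f (snd z)" for z :: "'a \<times> 'b" by (rule is_dist_nonneg[OF d(2)])
    have "{z :: 'a \<times> 'b. fst z = a} = range (Pair a)" for a by auto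
    then show "(\<Sum>z | fst z = a. m2 f (snd z)) \<le> 1" for a :: 'a
      using d(2) by (simp add: sum.reindex inj_on_def is_dist_def)
    show "0 < m2 f (snd z)" if "0 < m12 f z" for z
      using marg_pos[OF d(1) that, of snd] by (simp add: m)
  qed
  moreover have "(\<Sum>z\<in>UNIV. m12 f z * log 2 (m2 f (snd z))) = - entropy (m2 f)"
    unfolding entropy_alt m(2)[symmetric] sum_marg by simp
  ultimately show ?thesis by (simp add: MI_2_1_def m)
qed

section \<open>Compactness of the simplex and relaxation of the constraints\<close>

definition l1 :: "('c::finite \<Rightarrow> real) \<Rightarrow> ('c \<Rightarrow> real) \<Rightarrow> real" where
  "l1 f g = (\<Sum>c\<in>UNIV. \<bar>f c - g c\<bar>)"

lemma l1_nonneg: "0 \<le> l1 f g" by (simp add: l1_def sum_nonneg)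

lemma l1_le_0: "l1 f g \<le> 0 \<longleftrightarrow> f = g"
  using l1_nonneg[of f g] by (auto simp: l1_def sum_nonneg_eq_0_iff fun_eq_iff antisym_conv)

lemma l1_marg: "l1 (marg \<pi> f) (marg \<pi> g) \<le> l1 f g"
proof -
  have "l1 (marg \<pi> f) (marg \<pi> g) \<le> (\<Sum>v\<in>UNIV. \<Sum>z | \<pi> z = v. \<bar>f z - g z\<bar>)"
    unfolding l1_def marg_def sum_subtractf[symmetric] by (intro sum_mono sum_abs)
  also have "\<dots> = l1 f g"
    unfolding l1_def using sum.group[of UNIV UNIV \<pi> "\<lambda>z. \<bar>f z - g z\<bar>"] by simp
  finally show ?thesis .
qed

text \<open>In the product topology on functions, the simplex is a closed slice of the compact cube
  with sides [0, 1].\<close>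

lemma compact_dist: "compact {f :: 'c::finite \<Rightarrow> real. is_dist f}"
proof -
  have "compactin (product_topology (\<lambda>_::'c. euclideanreal) UNIV) (UNIV \<rightarrow>\<^sub>E {0..1})"
    by (subst compactin_PiE) auto
  then have K: "compact (UNIV \<rightarrow>\<^sub>E {0..1} :: ('c \<Rightarrow> real) set)"
    by (simp add: euclidean_product_topology)
  have "is_dist f \<Longrightarrow> f c \<le> 1" for f :: "'c \<Rightarrow> real" and c
    using member_le_sum[of c UNIV f] by (auto simp: is_dist_def)
  then have "{f :: 'c \<Rightarrow> real. is_dist f} = (UNIV \<rightarrow>\<^sub>E {0..1}) \<inter> ({f. sum f UNIV = 1})"
    by (auto simp: is_dist_def)
  moreover have "closed {f :: 'c \<Rightarrow> real. sum f UNIV = 1}"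
    by (intro closed_Collect_eq continuous_intros continuous_on_product_coordinates)
  ultimately show ?thesis using compact_Int_closed[OF K] by simp
qed

lemma continuous_on_x_log_x: "continuous_on {0..} (\<lambda>x::real. x * log 2 x)"
  unfolding continuous_on_def
proof
  fix x :: real assume "x \<in> {0..}"
  show "((\<lambda>x. x * log 2 x) \<longlongrightarrow> x * log 2 x) (at x within {0..})"
  proof (cases "x = 0")
    case True
    have "{0..} - {0::real} = {0<..} - {0}" by auto
    then have "at (0::real) within {0..} = at_right 0" by (simp only: at_within_def)
    moreover have "((\<lambda>x::real. x * log 2 x) \<longlongrightarrow> 0) (at_right 0)" by real_asymp
    ultimately show ?thesis by (simp add: True)
  next
    case False
    then show ?thesis using \<open>x \<in> {0..}\<close>
      by (intro tendsto_intros) auto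
  qed
qed

lemma continuous_on_marg: "continuous_on S (\<lambda>f. marg \<pi> f v)"
  unfolding marg_def by (intro continuous_intros continuous_on_subset[OF continuous_on_product_coordinates]) auto

lemma continuous_on_entropy_marg:
  "continuous_on {f. is_dist f} (\<lambda>f. entropy (marg \<pi> f))"
proof -
  have "continuous_on {f. is_dist f} (\<lambda>f. marg \<pi> f v * log 2 (marg \<pi> f v))" for v
    by (rule continuous_on_compose2[OF continuous_on_x_log_x continuous_on_marg])
      (auto intro!: is_dist_nonneg[OF is_dist_marg])
  then show ?thesis unfolding entropy_alt by (intro continuous_on_minus continuous_on_sum)
qed

lemma continuous_on_entropy: "continuous_on {f. is_dist f} entropy"
proof -
  have "marg (\<lambda>z. z) f = f" for f :: "'a::finite \<Rightarrow> real"
    by (auto simp: marg_def fun_eq_iff)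
  then show ?thesis using continuous_on_entropy_marg[of "\<lambda>z::'a. z"] by simp
qed

lemma continuous_on_MI:
  "continuous_on {f. is_dist f} MI_2_Y_given_1"
  "continuous_on {f. is_dist f} MI_1_Y"
  "continuous_on {f. is_dist f} MI_2_Y"
  "continuous_on {f. is_dist f} MI_2_1"
  "continuous_on {f. is_dist f} MI_1_Y2"
proof -
  note d = MI_2_Y_given_1_def MI_1_Y_def MI_2_Y_def MI_2_1_def MI_1_Y2_def
  show "continuous_on {f. is_dist f} MI_2_Y_given_1"
    "continuous_on {f. is_dist f} MI_1_Y"
    "continuous_on {f. is_dist f} MI_2_Y"
    "continuous_on {f. is_dist f} MI_2_1"
    "continuous_on {f. is_dist f} MI_1_Y2"
    unfolding d[abs_def] marginals by (intro continuous_intros continuous_on_entropy_marg continuous_on_entropy)+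
qed

lemma continuous_on_pos_part: "continuous_on S g \<Longrightarrow> continuous_on S (\<lambda>x. pos_part (g x))"
  unfolding pos_part_def by (intro continuous_intros)

text \<open>A real infimum is a lower bound only for values bounded below; continuity on the compact
  simplex secures this for all the feasible sets at once.\<close>

lemma cINF_dist:
  fixes g :: "('c::finite \<Rightarrow> real) \<Rightarrow> real"
  assumes "continuous_on {f. is_dist f} g" "\<And>f. f \<in> L \<Longrightarrow> is_dist f" "f \<in> L"
  shows "(INF f\<in>L. g f) \<le> g f"
proof (rule cINF_lower[OF _ assms(3)])
  have "compact (g ` {f. is_dist f})" by (rule compact_continuous_image[OF assms(1) compact_dist])
  then have "bdd_below (g ` {f. is_dist f})" by (intro bounded_imp_bdd_below compact_imp_bounded)
  then show "bdd_below (g ` L)" by (rule bdd_below_mono) (use assms(2) in auto)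
qed

text \<open>\<open>V\<close> measures the violation of constraints. The points of \<open>K\<close>
  where \<open>g\<close> is at most \<open>r\<close> form a compact set on which \<open>V\<close> is
  positive, so \<open>V\<close> has a positive minimum there, and half of it serves as
  \<open>d\<close>.\<close>

lemma compact_relax:
  fixes g V :: "'t::topological_space \<Rightarrow> real"
  assumes K: "compact K" and g: "continuous_on K g" and V: "continuous_on K V"
    and le: "\<And>f. f \<in> K \<Longrightarrow> V f \<le> 0 \<Longrightarrow> r < g f"
  obtains d where "0 < d" "\<And>f. f \<in> K \<Longrightarrow> V f \<le> d \<Longrightarrow> r < g f"
proof -
  let ?K = "K \<inter> g -` {..r}"
  have "closedin (top_of_set K) ?K"
    by (rule continuous_closedin_preimage[OF g]) simp
  then have cK: "compact ?K" by (rule closedin_compact[OF K])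
  show ?thesis
  proof (cases "?K = {}")
    case True
    then show ?thesis using that[of 1] by fastforce
  next
    case False
    obtain f0 where f0: "f0 \<in> ?K" "\<And>f. f \<in> ?K \<Longrightarrow> V f0 \<le> V f"
      using continuous_attains_inf[OF cK False continuous_on_subset[OF V]] by auto
    have "0 < V f0" using le[of f0] f0(1) by force
    then show ?thesis using f0(2) by (intro that[of "V f0 / 2"]) fastforce+
  qed
qed

lemma continuous_on_expect_metric: "continuous_on S (\<lambda>f. expect_metric f qt)"
  unfolding expect_metric_def case_prod_unfold
  by (intro continuous_intros continuous_on_subset[OF continuous_on_product_coordinates]) auto

lemma mem_setL:
  "f \<in> setL0 P qt \<longleftrightarrow> is_dist f \<and> m12 f = m12 P \<and> expect_metric P qt \<le> expect_metric f qt \<and> my f = my P"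
  "f \<in> setL1 P qt \<longleftrightarrow> is_dist f \<and> m12 f = m12 P \<and> expect_metric P qt \<le> expect_metric f qt \<and> m2y f = m2y P"
  "f \<in> setL2 P qt \<longleftrightarrow> is_dist f \<and> m12 f = m12 P \<and> expect_metric P qt \<le> expect_metric f qt \<and> m1y f = m1y P"
  by (auto simp: setL0_def setL1_def setL2_def setG_def)

text \<open>Types of codewords meet the constraints of \<open>setL0\<close> and \<open>setL2\<close>
  only approximately, even the one on \<open>m12\<close>. All violations are added up in a single
  \<open>V\<close>, so that one compactness argument serves both rate functions.\<close>

lemma relax_marginals:
  fixes \<pi> :: "'a1::finite \<times> 'a2::finite \<times> 'y::finite \<Rightarrow> 'b::finite"
    and \<rho> :: "'a1 \<times> 'a2 \<times> 'y \<Rightarrow> 'c::finite" and g :: "('a1, 'a2, 'y) jdist \<Rightarrow> real"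
  assumes g: "continuous_on {f. is_dist f} g"
    and lt: "\<And>f. is_dist f \<Longrightarrow> marg \<pi> f = marg \<pi> P \<Longrightarrow> marg \<rho> f = marg \<rho> P \<Longrightarrow>
        expect_metric P qt \<le> expect_metric f qt \<Longrightarrow> r < g f"
  obtains d where "0 < d" "\<And>f. is_dist f \<Longrightarrow> l1 (marg \<pi> f) (marg \<pi> P) \<le> d \<Longrightarrow>
      l1 (marg \<rho> f) (marg \<rho> P) \<le> d \<Longrightarrow> expect_metric P qt - d \<le> expect_metric f qt \<Longrightarrow> r < g f"
proof -
  define V where "V f = l1 (marg \<pi> f) (marg \<pi> P) + l1 (marg \<rho> f) (marg \<rho> P) +
    max 0 (expect_metric P qt - expect_metric f qt)" for f
  have V: "continuous_on {f. is_dist f} V"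
    unfolding V_def l1_def by (intro continuous_intros continuous_on_marg continuous_on_expect_metric)
  have le: "r < g f" if "f \<in> {f. is_dist f}" "V f \<le> 0" for f
  proof -
    have n: "0 \<le> l1 (marg \<pi> f) (marg \<pi> P)" "0 \<le> l1 (marg \<rho> f) (marg \<rho> P)"
      by (rule l1_nonneg)+
    have "l1 (marg \<pi> f) (marg \<pi> P) \<le> 0" "l1 (marg \<rho> f) (marg \<rho> P) \<le> 0"
      "expect_metric P qt \<le> expect_metric f qt"
      using that(2) n unfolding V_def by linarith+
    then show ?thesis using that(1) by (intro lt) (simp_all add: l1_le_0)
  qed
  obtain d where d: "0 < d" "\<And>f. is_dist f \<Longrightarrow> V f \<le> d \<Longrightarrow> r < g f"
    using compact_relax[OF compact_dist g V le] by (metis mem_Collect_eq)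
  \<comment> \<open>\<open>V\<close> has three summands, each at most \<open>d / 3\<close>.\<close>
  show ?thesis by (rule that[of "d / 3"]) (use d in \<open>auto simp: V_def intro!: d(2)\<close>)
qed

lemma R2'_relax:
  assumes P: "is_dist P" and r: "r < R2' P qt"
  obtains d where "0 < d" "\<And>f. is_dist f \<Longrightarrow> l1 (m12 f) (m12 P) \<le> d \<Longrightarrow>
      l1 (m1y f) (m1y P) \<le> d \<Longrightarrow> expect_metric P qt - d \<le> expect_metric f qt \<Longrightarrow>
      r < MI_2_Y_given_1 f"
proof -
  have "r < MI_2_Y_given_1 f"
    if "is_dist f" "m12 f = m12 P" "m1y f = m1y P" "expect_metric P qt \<le> expect_metric f qt" for f
  proof -
    have "R2' P qt \<le> MI_2_Y_given_1 f"
      unfolding R2'_def using that by (intro cINF_dist continuous_on_MI) (auto simp: mem_setL)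
    then show ?thesis using r by linarith
  qed
  from relax_marginals[OF continuous_on_MI(1) this[unfolded marginals]] obtain d where
    "0 < d" "\<And>f. is_dist f \<Longrightarrow> l1 (m12 f) (m12 P) \<le> d \<Longrightarrow>
      l1 (m1y f) (m1y P) \<le> d \<Longrightarrow> expect_metric P qt - d \<le> expect_metric f qt \<Longrightarrow>
      r < MI_2_Y_given_1 f" unfolding marginals by blast
  then show ?thesis by (rule that)
qed

lemma R1''_relax:
  assumes P: "is_dist P" and r: "r < R1'' P qt s"
  obtains d where "0 < d" "\<And>f. is_dist f \<Longrightarrow> l1 (m12 f) (m12 P) \<le> d \<Longrightarrow>
      l1 (my f) (my P) \<le> d \<Longrightarrow> expect_metric P qt - d \<le> expect_metric f qt \<Longrightarrow>
      r < MI_1_Y f + pos_part (MI_2_Y_given_1 f - s)"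
proof -
  have c: "continuous_on {f. is_dist f} (\<lambda>f. MI_1_Y f + pos_part (MI_2_Y_given_1 f - s))"
    by (intro continuous_on_add continuous_on_MI continuous_on_pos_part continuous_on_diff continuous_on_const)
  have "r < MI_1_Y f + pos_part (MI_2_Y_given_1 f - s)"
    if "is_dist f" "m12 f = m12 P" "my f = my P" "expect_metric P qt \<le> expect_metric f qt" for f
  proof -
    have "R1'' P qt s \<le> MI_1_Y f + pos_part (MI_2_Y_given_1 f - s)"
      unfolding R1''_def using that by (intro cINF_dist[OF c]) (auto simp: mem_setL)
    then show ?thesis using r by linarith
  qed
  from relax_marginals[OF c this[unfolded marginals]] obtain d where
    "0 < d" "\<And>f. is_dist f \<Longrightarrow> l1 (m12 f) (m12 P) \<le> d \<Longrightarrow>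
      l1 (my f) (my P) \<le> d \<Longrightarrow> expect_metric P qt - d \<le> expect_metric f qt \<Longrightarrow>
      r < MI_1_Y f + pos_part (MI_2_Y_given_1 f - s)" unfolding marginals by blast
  then show ?thesis by (rule that)
qed

section \<open>Exchange of the two auxiliary alphabets\<close>

definition swap12 :: "('a1, 'a2, 'y) jdist \<Rightarrow> ('a2, 'a1, 'y) jdist" where
  "swap12 f = (\<lambda>(b, a, y). f (a, b, y))"

lemma swap12_swap12 [simp]: "swap12 (swap12 f) = f"
  by (auto simp: swap12_def)

lemma sum_reindex_bij: "bij h \<Longrightarrow> (\<Sum>x\<in>UNIV. g (h x)) = (\<Sum>x\<in>UNIV. g x)"
  by (rule sum.reindex_bij_betw)

lemma entropy_bij: "bij h \<Longrightarrow> entropy (\<lambda>x. f (h x)) = entropy f"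
  unfolding entropy_alt by (subst sum_reindex_bij[where g = "\<lambda>x. f x * log 2 (f x)", symmetric]) auto

lemma bij_swap12: "bij (\<lambda>(b, a, y). (a, b, y))"
  by (rule o_bij[where g = "\<lambda>(b, a, y). (a, b, y)"]) auto

lemma swap12_alt: "swap12 f = (\<lambda>z. f ((\<lambda>(b, a, y). (a, b, y)) z))"
  by (auto simp: swap12_def)

lemma swap12_marginals:
  "m12 (swap12 f) = (\<lambda>z. m12 f (prod.swap z))" "m1y (swap12 f) = m2y f" "m2y (swap12 f) = m1y f"
  "m1 (swap12 f) = m2 f" "m2 (swap12 f) = m1 f" "my (swap12 f) = my f"
proof -
  show "my (swap12 f) = my f"
    unfolding my_def
    by (auto simp: fun_eq_iff swap12_def case_prod_unfold intro!: sum.reindex_bij_witness[of _ prod.swap prod.swap])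
qed (auto simp: fun_eq_iff swap12_def m12_def m1y_def m2y_def m1_def m2_def)

lemma swap12_is_dist: "is_dist f \<Longrightarrow> is_dist (swap12 f)"
  using sum_reindex_bij[OF bij_swap12, of f] by (auto simp: swap12_alt is_dist_def)

lemma swap12_expect: "expect_metric (swap12 f) (\<lambda>b a y. qt a b y) = expect_metric f qt"
  using sum_reindex_bij[OF bij_swap12, of "\<lambda>(a, b, y). f (a, b, y) * qt a b y"]
  by (simp add: expect_metric_def swap12_def case_prod_unfold)

lemma swap12_entropy: "entropy (swap12 f) = entropy f"
  unfolding swap12_alt by (rule entropy_bij[OF bij_swap12])

lemma entropy_swap: "entropy (\<lambda>z. f (prod.swap z)) = entropy f"
  by (rule entropy_bij) simp

lemma swap12_MI:
  "MI_1_Y (swap12 f) = MI_2_Y f"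
  "MI_2_Y_given_1 (swap12 f) = MI_1_Y2 f - MI_2_1 f"
  by (simp_all add: MI_1_Y_def MI_2_Y_def MI_2_Y_given_1_def MI_1_Y2_def MI_2_1_def
      swap12_marginals swap12_entropy entropy_swap)

lemma swap12_setL0:
  assumes "f \<in> setL0 (swap12 P) (\<lambda>b a y. qt a b y)" shows "swap12 f \<in> setL0 P qt"
proof -
  have "m12 (swap12 f) = m12 P" using assms unfolding mem_setL swap12_marginals by (auto simp: fun_eq_iff)
  then show ?thesis using assms swap12_expect[of "swap12 f" qt]
    by (auto simp: mem_setL swap12_marginals swap12_is_dist swap12_expect)
qed

lemma swap12_setL2:
  assumes "f \<in> setL2 (swap12 P) (\<lambda>b a y. qt a b y)" shows "swap12 f \<in> setL1 P qt"
proof -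
  have "m12 (swap12 f) = m12 P" using assms unfolding mem_setL swap12_marginals by (auto simp: fun_eq_iff)
  then show ?thesis using assms swap12_expect[of "swap12 f" qt]
    by (auto simp: mem_setL swap12_marginals swap12_is_dist swap12_expect)
qed

text \<open>Every feasible set fixes the joint law of \<open>X1\<close> and \<open>X2\<close>, so
  this term of \<open>R2''\<close> is constant over the minimisation.\<close>

lemma MI_2_1_eq:
  fixes f P :: "('a::finite, 'b::finite, 'c::finite) jdist"
  assumes "m12 f = m12 P" shows "MI_2_1 f = MI_2_1 P"
proof -
  have "m1 f = marg fst (m12 f)" "m2 f = marg snd (m12 f)" for f :: "('a, 'b, 'c) jdist"
    by (simp_all add: marginals marg_marg case_prod_unfold)
  then show ?thesis using assms by (simp add: MI_2_1_def)
qed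

lemma R_bin_cog_sum:
  fixes P :: "('a::finite, 'b::finite, 'c::finite) jdist"
  assumes P: "is_dist P" and R: "(R1, R2) \<in> R_bin_cog P qt"
  shows "\<exists>S1 S2. S1 + S2 = R1 + R2 \<and>
    ((S1, S2) \<in> R_sup_cog P qt \<or> (S1, S2) \<in> R_sup_cog (swap12 P) (\<lambda>b a y. qt a b y))"
proof -
  obtain A Rb where A: "0 \<le> A" "0 \<le> Rb" "R1 = A + Rb" "0 \<le> R2" "A \<le> R1' P qt" "Rb + R2 \<le> R2' P qt"
    "A \<le> R1'' P qt (Rb + R2) \<or> Rb + R2 \<le> R2'' P qt A"
    using R by (auto simp: R_bin_cog_def)
  define B where "B = Rb + R2"
  have B: "0 \<le> B" "R1 + R2 = A + B" using A by (auto simp: B_def)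
  show ?thesis
  proof (cases "A \<le> R1'' P qt B")
    case True
    then have "(A, B) \<in> R_sup_cog P qt" using A B by (auto simp: R_sup_cog_def B_def)
    then show ?thesis using B by auto
  next
    case False
    then have BR: "B \<le> R2'' P qt A" using A by (auto simp: B_def)
    let ?P = "swap12 P" and ?qt = "\<lambda>b a y. qt a b y"
    define I where "I = MI_2_1 P"
    \<comment> \<open>The cut at 0 treats \<open>A \<ge> I\<close> and \<open>A < I\<close>
      together; \<open>B'\<close> takes whatever is left of the sum rate.\<close>
    define A' where "A' = max 0 (A - I)"
    define B' where "B' = A + B - A'"
    have L1: "A \<le> MI_1_Y2 f" if "f \<in> setL1 P qt" for f
    proof -
      have "R1' P qt \<le> MI_1_Y2 f" unfolding R1'_def
        by (rule cINF_dist[OF continuous_on_MI(5) _ that]) (auto simp: mem_setL)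
      then show ?thesis using A by simp
    qed
    have L0: "B \<le> MI_2_Y f - I + pos_part (MI_1_Y2 f - A)" if "f \<in> setL0 P qt" for f
    proof -
      have "R2'' P qt A \<le> MI_2_Y f - MI_2_1 f + pos_part (MI_1_Y2 f - A)" unfolding R2''_def
        by (rule cINF_dist[OF _ _ that])
          (auto simp: mem_setL intro!: continuous_on_add continuous_on_diff continuous_on_MI continuous_on_pos_part continuous_on_const)
      moreover have "MI_2_1 f = I" unfolding I_def using that by (intro MI_2_1_eq) (simp add: mem_setL)
      ultimately show ?thesis using BR by simp
    qed
    have nn: "I \<le> MI_1_Y2 f" if "is_dist f" "m12 f = m12 P" for f :: "('a, 'b, 'c) jdist"
      using MI_2_Y_given_1_nonneg[OF swap12_is_dist[OF that(1)]] MI_2_1_eq[OF that(2)]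
      by (simp add: swap12_MI I_def)
    have "A' \<le> R2' ?P ?qt" unfolding R2'_def
    proof (rule cINF_greatest)
      have "?P \<in> setL2 ?P ?qt" using P by (auto simp: mem_setL swap12_is_dist)
      then show "setL2 ?P ?qt \<noteq> {}" by blast
      fix f assume "f \<in> setL2 ?P ?qt"
      then have *: "swap12 f \<in> setL1 P qt" by (rule swap12_setL2)
      then have "MI_2_1 (swap12 f) = I" "is_dist (swap12 f)" "m12 (swap12 f) = m12 P"
        unfolding I_def by (auto simp: mem_setL intro!: MI_2_1_eq)
      \<comment> \<open>The right side is I(X1;Y,X2) - I for \<open>swap12 f\<close>:
        \<open>L1\<close> bounds it below by \<open>A - I\<close>, and \<open>nn\<close> by
        0.\<close>
      then show "A' \<le> MI_2_Y_given_1 f"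
        using L1[OF *] nn[of "swap12 f"] swap12_MI(2)[of "swap12 f"] by (simp add: A'_def)
    qed
    moreover have "B' \<le> R1'' ?P ?qt A'" unfolding R1''_def
    proof (rule cINF_greatest)
      have "?P \<in> setL0 ?P ?qt" using P by (auto simp: mem_setL swap12_is_dist)
      then show "setL0 ?P ?qt \<noteq> {}" by blast
      fix f assume "f \<in> setL0 ?P ?qt"
      then have *: "swap12 f \<in> setL0 P qt" by (rule swap12_setL0)
      then have "MI_2_1 (swap12 f) = I" "is_dist (swap12 f)" "m12 (swap12 f) = m12 P"
        unfolding I_def by (auto simp: mem_setL intro!: MI_2_1_eq)
      \<comment> \<open>If \<open>A \<ge> I\<close>, then \<open>B' = B + I\<close>, the positive
        part is the one in \<open>L0\<close>, and the claim is \<open>L0\<close> with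
        \<open>I\<close> moved across. If \<open>A < I\<close>, then \<open>B' = A + B\<close>; by
        \<open>nn\<close>, I(X1;Y,X2) is at least \<open>I\<close> and so exceeds \<open>A\<close>,
        hence both positive parts are plain differences and the claim is \<open>L0\<close> with
        \<open>A\<close> moved across.\<close>
      then show "B' \<le> MI_1_Y f + pos_part (MI_2_Y_given_1 f - A')"
        using L0[OF *] nn[of "swap12 f"] swap12_MI[of "swap12 f"]
        by (auto simp: A'_def B'_def pos_part_def max_def split: if_splits)
    qed
    moreover have "0 \<le> A'" "0 \<le> B'"
      using B A(1) MI_2_1_nonneg[OF P] by (auto simp: A'_def B'_def I_def)
    ultimately have "(B', A') \<in> R_sup_cog ?P ?qt" by (simp add: R_sup_cog_def)
    then show ?thesis using B by (intro exI[of _ B'] exI[of _ A']) (auto simp: B'_def)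
  qed
qed

section \<open>Product distributions and random superposition codes\<close>

text \<open>Independence of two coordinates under a product law: \<open>p\<close> and
  \<open>q\<close> are absorbed into the factors at \<open>i\<close> and \<open>j\<close>, and each
  other factor sums to 1 once sum and product are interchanged.\<close>

lemma sum_PiE_coord2_prod:
  fixes w :: "'a \<Rightarrow> real"
  assumes I: "finite I" "i \<in> I" "j \<in> I" "i \<noteq> j" and A: "finite A" and w: "(\<Sum>a\<in>A. w a) = 1"
  shows "(\<Sum>g\<in>I \<rightarrow>\<^sub>E A. (\<Prod>x\<in>I. w (g x)) * (p (g i) * q (g j))) =
    (\<Sum>a\<in>A. w a * p a) * (\<Sum>a\<in>A. w a * q a)"
proof -
  let ?h = "\<lambda>x a. if x = i then p a else if x = j then q a else 1"
  have I': "I = insert i (insert j (I - {i, j}))" using I by auto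
  have split: "(\<Prod>x\<in>I. F x) = F i * (F j * (\<Prod>x\<in>I - {i, j}. F x))" for F :: "_ \<Rightarrow> real"
    using I by (subst I') (auto simp: prod.insert)
  have "(\<Prod>x\<in>I. w (g x)) * (p (g i) * q (g j)) = (\<Prod>x\<in>I. w (g x) * ?h x (g x))" for g
    unfolding split[of "\<lambda>x. w (g x)"] split[of "\<lambda>x. w (g x) * ?h x (g x)"] using I by simp
  then have "(\<Sum>g\<in>I \<rightarrow>\<^sub>E A. (\<Prod>x\<in>I. w (g x)) * (p (g i) * q (g j))) = (\<Prod>x\<in>I. \<Sum>a\<in>A. w a * ?h x a)"
    using I A by (subst prod_sum_PiE) auto
  also have "\<dots> = (\<Sum>a\<in>A. w a * p a) * (\<Sum>a\<in>A. w a * q a)"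
  proof -
    have "(\<Prod>x\<in>I - {i, j}. \<Sum>a\<in>A. w a * ?h x a) = 1" using w by (intro prod.neutral) auto
    then show ?thesis unfolding split[of "\<lambda>x. \<Sum>a\<in>A. w a * ?h x a"] using I by simp
  qed
  finally show ?thesis .
qed

text \<open>Expanding \<open>F\<close> in the indicators of the value at \<open>j\<close> reduces a
  joint function of two coordinates to sums of products.\<close>

lemma sum_PiE_coord2:
  fixes w :: "'a \<Rightarrow> real"
  assumes I: "finite I" "i \<in> I" "j \<in> I" "i \<noteq> j" and A: "finite A" and w: "(\<Sum>a\<in>A. w a) = 1"
  shows "(\<Sum>g\<in>I \<rightarrow>\<^sub>E A. (\<Prod>x\<in>I. w (g x)) * F (g i) (g j)) =
    (\<Sum>a\<in>A. w a * (\<Sum>b\<in>A. w b * F a b))"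
proof -
  have "(\<Sum>g\<in>I \<rightarrow>\<^sub>E A. (\<Prod>x\<in>I. w (g x)) * F (g i) (g j)) =
      (\<Sum>g\<in>I \<rightarrow>\<^sub>E A. \<Sum>b\<in>A. (\<Prod>x\<in>I. w (g x)) * (F (g i) b * of_bool (g j = b)))"
  proof (rule sum.cong)
    fix g assume "g \<in> I \<rightarrow>\<^sub>E A"
    then have "g j \<in> A" using I by auto
    then show "(\<Prod>x\<in>I. w (g x)) * F (g i) (g j) =
        (\<Sum>b\<in>A. (\<Prod>x\<in>I. w (g x)) * (F (g i) b * of_bool (g j = b)))"
      unfolding sum_distrib_left[symmetric]
      using A by (simp add: of_bool_def if_distrib[of "\<lambda>x. _ * x"] cong: if_cong)
  qed simp
  also have "\<dots> = (\<Sum>b\<in>A. (\<Sum>a\<in>A. w a * F a b) * (\<Sum>a\<in>A. w a * of_bool (a = b)))"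
    by (subst sum.swap)
      (rule sum.cong[OF refl], rule sum_PiE_coord2_prod[OF I A w, where q = "\<lambda>a. of_bool (a = _)"])
  also have "\<dots> = (\<Sum>b\<in>A. (\<Sum>a\<in>A. w a * F a b) * w b)"
    using A by (intro sum.cong refl) (simp add: of_bool_def if_distrib[of "\<lambda>x. _ * x"] cong: if_cong)
  also have "\<dots> = (\<Sum>a\<in>A. w a * (\<Sum>b\<in>A. w b * F a b))"
    unfolding sum_distrib_right sum_distrib_left by (subst sum.swap) (simp add: mult_ac)
  finally show ?thesis .
qed

lemma sum_PiE_coord1:
  fixes w :: "'a \<Rightarrow> real"
  assumes I: "finite I" "i \<in> I" and A: "finite A" and w: "(\<Sum>a\<in>A. w a) = 1"
  shows "(\<Sum>g\<in>I \<rightarrow>\<^sub>E A. (\<Prod>x\<in>I. w (g x)) * p (g i)) = (\<Sum>a\<in>A. w a * p a)"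
proof -
  let ?h = "\<lambda>x a. if x = i then p a else 1"
  have split: "(\<Prod>x\<in>I. F x) = F i * (\<Prod>x\<in>I - {i}. F x)" for F :: "_ \<Rightarrow> real"
    using I by (rule prod.remove)
  have "(\<Prod>x\<in>I. w (g x)) * p (g i) = (\<Prod>x\<in>I. w (g x) * ?h x (g x))" for g
    unfolding split[of "\<lambda>x. w (g x)"] split[of "\<lambda>x. w (g x) * ?h x (g x)"] by simp
  then have "(\<Sum>g\<in>I \<rightarrow>\<^sub>E A. (\<Prod>x\<in>I. w (g x)) * p (g i)) = (\<Prod>x\<in>I. \<Sum>a\<in>A. w a * ?h x a)"
    using I A by (subst prod_sum_PiE) auto
  also have "\<dots> = (\<Sum>a\<in>A. w a * p a)"
  proof -
    have "(\<Prod>x\<in>I - {i}. \<Sum>a\<in>A. w a * ?h x a) = 1" using w by (intro prod.neutral) auto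
    then show ?thesis unfolding split[of "\<lambda>x. \<Sum>a\<in>A. w a * ?h x a"] by simp
  qed
  finally show ?thesis .
qed

lemma sum_PiE_total:
  fixes w :: "'a \<Rightarrow> real"
  assumes "finite I" "finite A" "(\<Sum>a\<in>A. w a) = 1"
  shows "(\<Sum>g\<in>I \<rightarrow>\<^sub>E A. \<Prod>x\<in>I. w (g x)) = 1"
  using assms by (subst prod_sum_PiE[symmetric]) auto

section \<open>Concentration of types and the random code\<close>

definition iid :: "('c \<Rightarrow> real) \<Rightarrow> nat \<Rightarrow> (nat \<Rightarrow> 'c) \<Rightarrow> real" where
  "iid p n z = (\<Prod>t<n. p (z t))"

abbreviation seqs :: "nat \<Rightarrow> (nat \<Rightarrow> 'c) set" where
  "seqs n \<equiv> {..<n} \<rightarrow>\<^sub>E UNIV"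

lemma finite_seqs: "finite (seqs n :: (nat \<Rightarrow> 'c::finite) set)"
  by (intro finite_PiE) auto

lemma iid_nonneg: "(\<And>c. 0 \<le> p c) \<Longrightarrow> 0 \<le> iid p n z"
  by (simp add: iid_def prod_nonneg)

text \<open>Chebyshev's inequality for each letter: the centred indicators \<open>d c\<close> at
  distinct positions are uncorrelated, so their sum has second moment at most \<open>n\<close>. One
  factor \<open>CARD('c)\<close> comes from comparing the squared \<open>l1\<close> norm with the
  sum of squares, the other from summing over letters.\<close>

lemma type_concentration:
  fixes p :: "'c::finite \<Rightarrow> real"
  assumes p: "is_dist p" and n: "0 < n" and \<eta>: "0 < \<eta>"
  shows "(\<Sum>z\<in>seqs n. iid p n z * of_bool (\<eta> < l1 (emp n z) p)) \<le> (real CARD('c))\<^sup>2 / (\<eta>\<^sup>2 * real n)"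
proof -
  define d where "d c x = of_bool (x = c) - p c" for c x :: 'c
  have s1: "(\<Sum>c\<in>UNIV. p c) = 1" using p by (simp add: is_dist_def)
  have p0: "0 \<le> p c" for c using p by (simp add: is_dist_def)
  have p1: "p c \<le> 1" for c using member_le_sum[of c UNIV p] p0 s1 by auto
  have d0: "(\<Sum>x\<in>UNIV. p x * d c x) = 0" for c
    using s1 by (simp add: d_def right_diff_distrib sum_subtractf sum_distrib_right[symmetric]
        of_bool_def if_distrib[of "\<lambda>x. _ * x"] cong: if_cong)
  have d1: "(d c x)\<^sup>2 \<le> 1" for c x
    unfolding abs_square_le_1 using p0[of c] p1[of c] by (auto simp: d_def)
  have var: "(\<Sum>z\<in>seqs n. iid p n z * (\<Sum>t<n. d c (z t))\<^sup>2) \<le> real n" for c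
  proof -
    have cov: "(\<Sum>z\<in>seqs n. iid p n z * (d c (z s) * d c (z t))) \<le> of_bool (s = t)"
      if "s < n" "t < n" for s t
    proof (cases "s = t")
      case True
      have "(\<Sum>z\<in>seqs n. iid p n z * (d c (z t) * d c (z t))) = (\<Sum>x\<in>UNIV. p x * (d c x)\<^sup>2)"
        unfolding iid_def power2_eq_square using that s1
        by (intro sum_PiE_coord1[where p = "\<lambda>x. d c x * d c x"]) auto
      also have "\<dots> \<le> (\<Sum>x\<in>UNIV. p x * 1)" by (intro sum_mono mult_left_mono d1 p0)
      finally show ?thesis using True s1 by simp
    next
      case False
      have "(\<Sum>z\<in>seqs n. iid p n z * (d c (z s) * d c (z t))) = 0"
        unfolding iid_def using False that s1 d0[of c] by (subst sum_PiE_coord2_prod) auto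
      then show ?thesis by simp
    qed
    have "(\<Sum>z\<in>seqs n. iid p n z * (\<Sum>t<n. d c (z t))\<^sup>2) =
        (\<Sum>z\<in>seqs n. \<Sum>s<n. \<Sum>t<n. iid p n z * (d c (z s) * d c (z t)))"
      unfolding power2_eq_square sum_product by (simp add: sum_distrib_left)
    also have "\<dots> = (\<Sum>s<n. \<Sum>t<n. \<Sum>z\<in>seqs n. iid p n z * (d c (z s) * d c (z t)))"
      by (subst sum.swap, intro sum.cong refl, subst sum.swap, rule refl)
    also have "\<dots> \<le> (\<Sum>s<n. \<Sum>t<n. of_bool (s = t))"
      by (intro sum_mono cov) auto
    also have "\<dots> = real n" by (simp add: of_bool_def)
    finally show ?thesis .
  qed
  have e: "emp n z c - p c = (\<Sum>t<n. d c (z t)) / real n" for z c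
    using n by (simp add: emp_def d_def sum_subtractf diff_divide_distrib)
  have "of_bool (\<eta> < l1 (emp n z) p) \<le> real CARD('c) / (\<eta>\<^sup>2 * (real n)\<^sup>2) * (\<Sum>c\<in>UNIV. (\<Sum>t<n. d c (z t))\<^sup>2)" for z
  proof -
    have "of_bool (\<eta> < l1 (emp n z) p) \<le> (l1 (emp n z) p)\<^sup>2 / \<eta>\<^sup>2"
      using \<eta> by (auto simp: of_bool_def power_mono)
    also have "(l1 (emp n z) p)\<^sup>2 \<le> (\<Sum>c\<in>UNIV. \<bar>emp n z c - p c\<bar>\<^sup>2) * real CARD('c)"
      unfolding l1_def by (rule sum_squared_le_sum_of_squares)
    also have "(\<Sum>c\<in>UNIV. \<bar>emp n z c - p c\<bar>\<^sup>2) = (\<Sum>c\<in>UNIV. (\<Sum>t<n. d c (z t))\<^sup>2) / (real n)\<^sup>2"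
      by (simp only: e power2_abs power_divide sum_divide_distrib[symmetric])
    finally show ?thesis using \<eta> n by (simp add: divide_right_mono field_simps)
  qed
  then have "(\<Sum>z\<in>seqs n. iid p n z * of_bool (\<eta> < l1 (emp n z) p)) \<le>
      (\<Sum>z\<in>seqs n. iid p n z * (real CARD('c) / (\<eta>\<^sup>2 * (real n)\<^sup>2) * (\<Sum>c\<in>UNIV. (\<Sum>t<n. d c (z t))\<^sup>2)))"
    by (intro sum_mono mult_left_mono iid_nonneg p0)
  also have "\<dots> = real CARD('c) / (\<eta>\<^sup>2 * (real n)\<^sup>2) * (\<Sum>c\<in>UNIV. \<Sum>z\<in>seqs n. iid p n z * (\<Sum>t<n. d c (z t))\<^sup>2)"
    unfolding sum_distrib_left by (subst sum.swap) (simp only: mult.left_commute)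
  also have "\<dots> \<le> real CARD('c) / (\<eta>\<^sup>2 * (real n)\<^sup>2) * (\<Sum>c\<in>(UNIV::'c set). real n)"
    using \<eta> by (intro mult_left_mono sum_mono var) auto
  also have "\<dots> = (real CARD('c))\<^sup>2 / (\<eta>\<^sup>2 * real n)"
    using n by (simp add: power2_eq_square)
  finally show ?thesis .
qed

lemma weighted_average_le:
  fixes w f :: "'a \<Rightarrow> real"
  assumes "finite A" "\<And>a. a \<in> A \<Longrightarrow> 0 \<le> w a" "sum w A = 1" "(\<Sum>a\<in>A. w a * f a) \<le> b"
  obtains a where "a \<in> A" "f a \<le> b"
proof -
  have "\<exists>a\<in>A. f a \<le> b"
  proof (rule ccontr)
    assume "\<not> ?thesis"
    then have gt: "b < f a" if "a \<in> A" for a using that by force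
    have "0 < (\<Sum>a\<in>A. w a * (f a - b))"
    proof -
      obtain a where a: "a \<in> A" "w a \<noteq> 0" using assms(3) by (metis sum.neutral zero_neq_one)
      then show ?thesis using assms(2)[OF a(1)] gt[OF a(1)]
        by (intro sum_pos2[OF assms(1) a(1)]) (auto intro!: mult_nonneg_nonneg less_imp_le[OF gt] assms(2))
    qed
    then show False using assms(3,4)
      by (simp add: right_diff_distrib sum_subtractf flip: sum_distrib_right)
  qed
  then show ?thesis using that by blast
qed

text \<open>
  \<open>G\<close> is the event that the transmitted pair is typical with the output, and \<open>B\<close> the event that a
  competitor is a threat, stated without reference to the transmitted codeword so that it can be
  averaged independently. Message \<open>m\<close> is sent as satellite \<open>m mod M\<^sub>2\<close> of cloud \<open>m div M\<^sub>2\<close>.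
\<close>

lemma superposition_random_coding:
  fixes \<mu>\<^sub>1 :: "'u \<Rightarrow> real" and \<mu>\<^sub>2 :: "'u \<Rightarrow> 'v \<Rightarrow> real" and K :: "'u \<Rightarrow> 'v \<Rightarrow> 'y \<Rightarrow> real"
    and M M\<^sub>1 M\<^sub>2 :: nat
  assumes fin: "finite S" "\<And>u. finite (T u)" "finite Y"
    and nonneg: "\<And>u. 0 \<le> \<mu>\<^sub>1 u" "\<And>u v. 0 \<le> \<mu>\<^sub>2 u v" "\<And>u v y. 0 \<le> K u v y"
    and sum1: "(\<Sum>u\<in>S. \<mu>\<^sub>1 u) = 1" and sum2: "\<And>u. u \<in> S \<Longrightarrow> (\<Sum>v\<in>T u. \<mu>\<^sub>2 u v) = 1"
    and K: "\<And>u v. (\<Sum>y\<in>Y. K u v y) \<le> 1"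
    and e1: "(\<Sum>u\<in>S. \<mu>\<^sub>1 u * (\<Sum>v\<in>T u. \<mu>\<^sub>2 u v * (\<Sum>y\<in>Y. K u v y * of_bool (\<not> G u v y)))) \<le> e1"
    and e2: "\<And>u v y. u \<in> S \<Longrightarrow> v \<in> T u \<Longrightarrow> G u v y \<Longrightarrow>
      (\<Sum>v'\<in>T u. \<mu>\<^sub>2 u v' * of_bool (B u v' y)) \<le> e2"
    and e3: "\<And>u v y. u \<in> S \<Longrightarrow> v \<in> T u \<Longrightarrow> G u v y \<Longrightarrow>
      (\<Sum>u'\<in>S. \<mu>\<^sub>1 u' * min 1 (real M\<^sub>2 * (\<Sum>v'\<in>T u'. \<mu>\<^sub>2 u' v' * of_bool (B u' v' y)))) \<le> e3"
    and e: "0 \<le> e2" "0 \<le> e3"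
    and M: "0 < M" "M \<le> M\<^sub>1 * M\<^sub>2"
  obtains x\<^sub>1 x\<^sub>2 where
    "(\<Sum>m<M. \<Sum>y\<in>Y. K (x\<^sub>1 (m div M\<^sub>2)) (x\<^sub>2 (m div M\<^sub>2) (m mod M\<^sub>2)) y *
        of_bool (\<not> G (x\<^sub>1 (m div M\<^sub>2)) (x\<^sub>2 (m div M\<^sub>2) (m mod M\<^sub>2)) y \<or>
          (\<exists>m'<M. m' \<noteq> m \<and> B (x\<^sub>1 (m' div M\<^sub>2)) (x\<^sub>2 (m' div M\<^sub>2) (m' mod M\<^sub>2)) y))) / real M
      \<le> e1 + (real M\<^sub>2 - 1) * e2 + (real M\<^sub>1 - 1) * e3"
proof -
  \<comment> \<open>A point of \<open>C\<close> is a whole cloud, centre together with satellites;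
    satellites are independent only given their centre. Clouds are drawn independently by
    \<open>\<Omega>\<close>, so the random code is a product law on two levels.\<close>
  define C where "C = (SIGMA u:S. {..<M\<^sub>2} \<rightarrow>\<^sub>E T u)"
  define \<omega> where "\<omega> c = \<mu>\<^sub>1 (fst c) * (\<Prod>j<M\<^sub>2. \<mu>\<^sub>2 (fst c) (snd c j))" for c
  define \<Omega> where "\<Omega> g = (\<Prod>i<M\<^sub>1. \<omega> (g i))" for g :: "nat \<Rightarrow> 'u \<times> (nat \<Rightarrow> 'v)"
  have M2: "0 < M\<^sub>2" and M1: "0 < M\<^sub>1" using M by (auto intro: Nat.gr0I)
  have finC: "finite C" unfolding C_def by (intro finite_SigmaI fin finite_PiE) auto
  have \<omega>0: "0 \<le> \<omega> c" for c unfolding \<omega>_def by (intro mult_nonneg_nonneg prod_nonneg nonneg ballI)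
  have cloud: "(\<Sum>c\<in>C. \<omega> c * F c) =
      (\<Sum>u\<in>S. \<mu>\<^sub>1 u * (\<Sum>s\<in>{..<M\<^sub>2} \<rightarrow>\<^sub>E T u. (\<Prod>j<M\<^sub>2. \<mu>\<^sub>2 u (s j)) * F (u, s)))" for F
    unfolding C_def \<omega>_def sum_distrib_left
    by (subst sum.Sigma) (auto simp: case_prod_unfold mult_ac fin intro!: finite_PiE)
  have total2: "(\<Sum>s\<in>{..<M\<^sub>2} \<rightarrow>\<^sub>E T u. \<Prod>j<M\<^sub>2. \<mu>\<^sub>2 u (s j)) = 1" if "u \<in> S" for u
    using that by (intro sum_PiE_total fin sum2) auto
  have \<omega>1: "(\<Sum>c\<in>C. \<omega> c) = 1"
    using cloud[of "\<lambda>_. 1"] by (simp add: total2 sum1)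
  have coord: "(\<Sum>c\<in>C. \<omega> c * F (fst c) (snd c j)) = (\<Sum>u\<in>S. \<mu>\<^sub>1 u * (\<Sum>v\<in>T u. \<mu>\<^sub>2 u v * F u v))"
    if "j < M\<^sub>2" for j F
    unfolding cloud using that
    by (intro sum.cong refl arg_cong2[where f = "(*)"])
      (simp add: sum_PiE_coord1[where p = "F _"] fin sum2)
  have \<Omega>0: "0 \<le> \<Omega> g" for g unfolding \<Omega>_def by (intro prod_nonneg \<omega>0 ballI)
  have \<Omega>1: "(\<Sum>g\<in>{..<M\<^sub>1} \<rightarrow>\<^sub>E C. \<Omega> g) = 1"
    unfolding \<Omega>_def by (intro sum_PiE_total finC \<omega>1) auto
  define A1 where "A1 j c = (\<Sum>y\<in>Y. K (fst c) (snd c j) y * of_bool (\<not> G (fst c) (snd c j) y))"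
    for j :: nat and c
  define A2 where "A2 j j' c = (\<Sum>y\<in>Y. K (fst c) (snd c j) y *
      (of_bool (G (fst c) (snd c j) y) * of_bool (B (fst c) (snd c j') y)))" for j j' :: nat and c
  \<comment> \<open>The threat from another cloud stays an existential statement over its
    satellites: summing over \<open>j'\<close> already here would lose the bound 1 on its
    probability.\<close>
  define A3 where "A3 j c c' = (\<Sum>y\<in>Y. K (fst c) (snd c j) y *
      (of_bool (G (fst c) (snd c j) y) * of_bool (\<exists>j'<M\<^sub>2. B (fst c') (snd c' j') y)))" for j :: nat and c c'
  have E1: "(\<Sum>c\<in>C. \<omega> c * A1 j c) \<le> e1" if "j < M\<^sub>2" for j
    unfolding A1_def
    using coord[OF that, of "\<lambda>u v. \<Sum>y\<in>Y. K u v y * of_bool (\<not> G u v y)"] e1 by simp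
  have avg: "(\<Sum>v\<in>T u. \<mu>\<^sub>2 u v * (\<Sum>y\<in>Y. K u v y * F v y)) \<le> b"
    if "u \<in> S" and b: "0 \<le> b" and F: "\<And>v y. v \<in> T u \<Longrightarrow> F v y \<le> b" for u F b
  proof -
    have "(\<Sum>y\<in>Y. K u v y * F v y) \<le> b" if v: "v \<in> T u" for v
    proof -
      have "(\<Sum>y\<in>Y. K u v y * F v y) \<le> (\<Sum>y\<in>Y. K u v y) * b"
        unfolding sum_distrib_right by (intro sum_mono mult_left_mono nonneg F v)
      also have "\<dots> \<le> 1 * b" by (intro mult_right_mono K b)
      finally show ?thesis by simp
    qed
    then have "(\<Sum>v\<in>T u. \<mu>\<^sub>2 u v * (\<Sum>y\<in>Y. K u v y * F v y)) \<le> (\<Sum>v\<in>T u. \<mu>\<^sub>2 u v * b)"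
      by (intro sum_mono mult_left_mono nonneg)
    also have "\<dots> = b" using sum2[OF that(1)] by (simp flip: sum_distrib_right)
    finally show ?thesis .
  qed
  have E2: "(\<Sum>c\<in>C. \<omega> c * A2 j j' c) \<le> e2" if j: "j < M\<^sub>2" "j' < M\<^sub>2" "j \<noteq> j'" for j j'
  proof -
    have "(\<Sum>s\<in>{..<M\<^sub>2} \<rightarrow>\<^sub>E T u. (\<Prod>j<M\<^sub>2. \<mu>\<^sub>2 u (s j)) * A2 j j' (u, s)) \<le> e2" if u: "u \<in> S" for u
    proof -
      have "(\<Sum>s\<in>{..<M\<^sub>2} \<rightarrow>\<^sub>E T u. (\<Prod>j<M\<^sub>2. \<mu>\<^sub>2 u (s j)) * A2 j j' (u, s)) =
         (\<Sum>v\<in>T u. \<mu>\<^sub>2 u v * (\<Sum>v'\<in>T u. \<mu>\<^sub>2 u v' * (\<Sum>y\<in>Y. K u v y * (of_bool (G u v y) * of_bool (B u v' y)))))"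
        unfolding A2_def fst_conv snd_conv using j u
        by (intro sum_PiE_coord2[where F = "\<lambda>v v'. \<Sum>y\<in>Y. K u v y * (of_bool (G u v y) * of_bool (B u v' y))"])
          (auto intro: fin sum2)
      also have "\<dots> = (\<Sum>v\<in>T u. \<mu>\<^sub>2 u v * (\<Sum>y\<in>Y. K u v y * (of_bool (G u v y) * (\<Sum>v'\<in>T u. \<mu>\<^sub>2 u v' * of_bool (B u v' y)))))"
        unfolding sum_distrib_left
        by (intro sum.cong refl, subst sum.swap) (simp add: mult_ac)
      also have "\<dots> \<le> e2"
        using u e e2[OF u] by (intro avg) (auto simp: of_bool_def)
      finally show ?thesis .
    qed
    then have "(\<Sum>c\<in>C. \<omega> c * A2 j j' c) \<le> (\<Sum>u\<in>S. \<mu>\<^sub>1 u * e2)"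
      unfolding cloud by (intro sum_mono mult_left_mono nonneg)
    also have "\<dots> = e2" using sum1 by (simp flip: sum_distrib_right)
    finally show ?thesis .
  qed
  \<comment> \<open>Both arguments of \<open>min\<close> bound the probability that a fresh cloud
    contains a threat: the first trivially, the second by the union bound over its
    satellites.\<close>
  have other: "(\<Sum>c'\<in>C. \<omega> c' * of_bool (\<exists>j'<M\<^sub>2. B (fst c') (snd c' j') y)) \<le>
      (\<Sum>u'\<in>S. \<mu>\<^sub>1 u' * min 1 (real M\<^sub>2 * (\<Sum>v'\<in>T u'. \<mu>\<^sub>2 u' v' * of_bool (B u' v' y))))" for y
    unfolding cloud fst_conv snd_conv
  proof (intro sum_mono mult_left_mono nonneg min.boundedI)
    fix u assume u: "u \<in> S"
    have w0: "0 \<le> (\<Prod>j<M\<^sub>2. \<mu>\<^sub>2 u (s j))" for s by (intro prod_nonneg nonneg ballI)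
    have "(\<Sum>s\<in>{..<M\<^sub>2} \<rightarrow>\<^sub>E T u. (\<Prod>j<M\<^sub>2. \<mu>\<^sub>2 u (s j)) * of_bool (\<exists>j'<M\<^sub>2. B u (s j') y)) \<le>
        (\<Sum>s\<in>{..<M\<^sub>2} \<rightarrow>\<^sub>E T u. (\<Prod>j<M\<^sub>2. \<mu>\<^sub>2 u (s j)) * 1)"
      by (intro sum_mono mult_left_mono w0) auto
    then show "(\<Sum>s\<in>{..<M\<^sub>2} \<rightarrow>\<^sub>E T u. (\<Prod>j<M\<^sub>2. \<mu>\<^sub>2 u (s j)) * of_bool (\<exists>j'<M\<^sub>2. B u (s j') y)) \<le> 1"
      using total2[OF u] by simp
    have "of_bool (\<exists>j'<M\<^sub>2. B u (s j') y) \<le> (\<Sum>j'<M\<^sub>2. of_bool (B u (s j') y) :: real)" for s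
    proof (cases "\<exists>j'<M\<^sub>2. B u (s j') y")
      case True
      then obtain j' where j': "j' < M\<^sub>2" "B u (s j') y" by blast
      then have "(1::real) \<le> of_bool (B u (s j') y)" by simp
      also have "\<dots> \<le> (\<Sum>j'<M\<^sub>2. of_bool (B u (s j') y))" using j' by (intro member_le_sum) auto
      finally show ?thesis using True by simp
    qed (simp add: sum_nonneg)
    then have "(\<Sum>s\<in>{..<M\<^sub>2} \<rightarrow>\<^sub>E T u. (\<Prod>j<M\<^sub>2. \<mu>\<^sub>2 u (s j)) * of_bool (\<exists>j'<M\<^sub>2. B u (s j') y)) \<le>
        (\<Sum>s\<in>{..<M\<^sub>2} \<rightarrow>\<^sub>E T u. (\<Prod>j<M\<^sub>2. \<mu>\<^sub>2 u (s j)) * (\<Sum>j'<M\<^sub>2. of_bool (B u (s j') y)))"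
      by (intro sum_mono mult_left_mono w0)
    also have "\<dots> = (\<Sum>j'<M\<^sub>2. \<Sum>s\<in>{..<M\<^sub>2} \<rightarrow>\<^sub>E T u. (\<Prod>j<M\<^sub>2. \<mu>\<^sub>2 u (s j)) * of_bool (B u (s j') y))"
      unfolding sum_distrib_left by (rule sum.swap)
    also have "\<dots> = (\<Sum>j'<M\<^sub>2. \<Sum>v'\<in>T u. \<mu>\<^sub>2 u v' * of_bool (B u v' y))"
      using u by (intro sum.cong refl sum_PiE_coord1[where p = "\<lambda>v. of_bool (B u v y)"]) (auto intro: fin sum2)
    finally show "(\<Sum>s\<in>{..<M\<^sub>2} \<rightarrow>\<^sub>E T u. (\<Prod>j<M\<^sub>2. \<mu>\<^sub>2 u (s j)) * of_bool (\<exists>j'<M\<^sub>2. B u (s j') y)) \<le>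
        real M\<^sub>2 * (\<Sum>v'\<in>T u. \<mu>\<^sub>2 u v' * of_bool (B u v' y))" by simp
  qed
  have E3: "(\<Sum>c\<in>C. \<omega> c * (\<Sum>c'\<in>C. \<omega> c' * A3 j c c')) \<le> e3" if j: "j < M\<^sub>2" for j
  proof -
    have "(\<Sum>c'\<in>C. \<omega> c' * A3 j c c') = (\<Sum>y\<in>Y. K (fst c) (snd c j) y *
        (of_bool (G (fst c) (snd c j) y) * (\<Sum>c'\<in>C. \<omega> c' * of_bool (\<exists>j'<M\<^sub>2. B (fst c') (snd c' j') y))))" for c
      unfolding A3_def sum_distrib_left by (subst sum.swap) (simp add: mult_ac)
    then have "(\<Sum>c\<in>C. \<omega> c * (\<Sum>c'\<in>C. \<omega> c' * A3 j c c')) =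
       (\<Sum>u\<in>S. \<mu>\<^sub>1 u * (\<Sum>v\<in>T u. \<mu>\<^sub>2 u v * (\<Sum>y\<in>Y. K u v y *
        (of_bool (G u v y) * (\<Sum>c'\<in>C. \<omega> c' * of_bool (\<exists>j'<M\<^sub>2. B (fst c') (snd c' j') y))))))"
      using coord[OF j, of "\<lambda>u v. \<Sum>y\<in>Y. K u v y *
        (of_bool (G u v y) * (\<Sum>c'\<in>C. \<omega> c' * of_bool (\<exists>j'<M\<^sub>2. B (fst c') (snd c' j') y)))"] by simp
    also have "\<dots> \<le> (\<Sum>u\<in>S. \<mu>\<^sub>1 u * e3)"
    proof (intro sum_mono mult_left_mono nonneg avg e)
      fix u v y assume "u \<in> S" "v \<in> T u"
      then show "of_bool (G u v y) * (\<Sum>c'\<in>C. \<omega> c' * of_bool (\<exists>j'<M\<^sub>2. B (fst c') (snd c' j') y)) \<le> e3"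
        using e e3[of u v y] other[of y] by (cases "G u v y") auto
    qed
    also have "\<dots> = e3" using sum1 by (simp flip: sum_distrib_right)
    finally show ?thesis .
  qed
  define err where "err g m = (\<Sum>y\<in>Y. K (fst (g (m div M\<^sub>2))) (snd (g (m div M\<^sub>2)) (m mod M\<^sub>2)) y *
        of_bool (\<not> G (fst (g (m div M\<^sub>2))) (snd (g (m div M\<^sub>2)) (m mod M\<^sub>2)) y \<or>
          (\<exists>m'<M. m' \<noteq> m \<and> B (fst (g (m' div M\<^sub>2))) (snd (g (m' div M\<^sub>2)) (m' mod M\<^sub>2)) y)))"
    for g and m :: nat
  have idx: "m div M\<^sub>2 < M\<^sub>1" "m mod M\<^sub>2 < M\<^sub>2" if "m < M" for m
    using that M M2 by (auto simp: less_mult_imp_div_less)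
  have union: "err g m \<le> A1 j (g i) + (\<Sum>j'\<in>{..<M\<^sub>2} - {j}. A2 j j' (g i)) + (\<Sum>i'\<in>{..<M\<^sub>1} - {i}. A3 j (g i) (g i'))"
    if m: "m < M" and i: "i = m div M\<^sub>2" and j: "j = m mod M\<^sub>2" for g m i j
  proof -
    have "of_bool (\<not> G (fst (g i)) (snd (g i) j) y \<or>
          (\<exists>m'<M. m' \<noteq> m \<and> B (fst (g (m' div M\<^sub>2))) (snd (g (m' div M\<^sub>2)) (m' mod M\<^sub>2)) y)) \<le>
        of_bool (\<not> G (fst (g i)) (snd (g i) j) y) +
        (\<Sum>j'\<in>{..<M\<^sub>2} - {j}. of_bool (G (fst (g i)) (snd (g i) j) y) * of_bool (B (fst (g i)) (snd (g i) j') y)) +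
        (\<Sum>i'\<in>{..<M\<^sub>1} - {i}. of_bool (G (fst (g i)) (snd (g i) j) y) * of_bool (\<exists>j'<M\<^sub>2. B (fst (g i')) (snd (g i') j') y) :: real)"
      (is "?l \<le> ?a + ?b + ?c") for y
    proof -
      have nn: "0 \<le> ?a" "0 \<le> ?b" "0 \<le> ?c" by (auto intro!: sum_nonneg)
      show ?thesis
      proof (cases "G (fst (g i)) (snd (g i) j) y \<and>
          (\<exists>m'<M. m' \<noteq> m \<and> B (fst (g (m' div M\<^sub>2))) (snd (g (m' div M\<^sub>2)) (m' mod M\<^sub>2)) y)")
        case False
        then have "?l \<le> ?a" by (auto simp: of_bool_def)
        then show ?thesis using nn by linarith
      next
        case True
        then obtain m' where m': "m' < M" "m' \<noteq> m" and b: "B (fst (g (m' div M\<^sub>2))) (snd (g (m' div M\<^sub>2)) (m' mod M\<^sub>2)) y"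
          and g: "G (fst (g i)) (snd (g i) j) y" by blast
        let ?i = "m' div M\<^sub>2" and ?j = "m' mod M\<^sub>2"
        have "1 \<le> ?b \<or> 1 \<le> ?c"
        proof (cases "?i = i")
          case True
          then have "?j \<noteq> j" using m'(2) i j by (metis div_mult_mod_eq)
          then have "of_bool (G (fst (g i)) (snd (g i) j) y) * of_bool (B (fst (g i)) (snd (g i) ?j) y) \<le> ?b"
            using idx[OF m'(1)] by (intro member_le_sum) auto
          then show ?thesis using b g True by simp
        next
          case False
          then have le: "of_bool (G (fst (g i)) (snd (g i) j) y) * of_bool (\<exists>j'<M\<^sub>2. B (fst (g ?i)) (snd (g ?i) j') y) \<le> ?c"
            using idx[OF m'(1)] by (intro member_le_sum) auto
          have "of_bool (G (fst (g i)) (snd (g i) j) y) * of_bool (\<exists>j'<M\<^sub>2. B (fst (g ?i)) (snd (g ?i) j') y) = (1::real)"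
            using b g idx[OF m'(1)] by auto
          from le[unfolded this] show ?thesis ..
        qed
        moreover have "?l \<le> 1" by simp
        ultimately show ?thesis using nn by linarith
      qed
    qed
    then have "err g m \<le> (\<Sum>y\<in>Y. K (fst (g i)) (snd (g i) j) y * (of_bool (\<not> G (fst (g i)) (snd (g i) j) y) +
        (\<Sum>j'\<in>{..<M\<^sub>2} - {j}. of_bool (G (fst (g i)) (snd (g i) j) y) * of_bool (B (fst (g i)) (snd (g i) j') y)) +
        (\<Sum>i'\<in>{..<M\<^sub>1} - {i}. of_bool (G (fst (g i)) (snd (g i) j) y) * of_bool (\<exists>j'<M\<^sub>2. B (fst (g i')) (snd (g i') j') y))))"
      unfolding err_def i[symmetric] j[symmetric] by (intro sum_mono mult_left_mono nonneg)
    also have "\<dots> = A1 j (g i) + (\<Sum>j'\<in>{..<M\<^sub>2} - {j}. A2 j j' (g i)) + (\<Sum>i'\<in>{..<M\<^sub>1} - {i}. A3 j (g i) (g i'))"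
      unfolding A1_def A2_def A3_def distrib_left sum.distrib
      by (intro arg_cong2[where f = "(+)"] refl; subst sum.swap; simp only: sum_distrib_left)
    finally show ?thesis .
  qed
  let ?b = "e1 + (real M\<^sub>2 - 1) * e2 + (real M\<^sub>1 - 1) * e3"
  have Eerr: "(\<Sum>g\<in>{..<M\<^sub>1} \<rightarrow>\<^sub>E C. \<Omega> g * err g m) \<le> ?b" if m: "m < M" for m
  proof -
    define i j where ij: "i = m div M\<^sub>2" "j = m mod M\<^sub>2"
    have i: "i < M\<^sub>1" and j: "j < M\<^sub>2" using idx[OF m] by (auto simp: ij)
    have "(\<Sum>g\<in>{..<M\<^sub>1} \<rightarrow>\<^sub>E C. \<Omega> g * err g m) \<le> (\<Sum>g\<in>{..<M\<^sub>1} \<rightarrow>\<^sub>E C. \<Omega> g * (A1 j (g i) +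
        (\<Sum>j'\<in>{..<M\<^sub>2} - {j}. A2 j j' (g i)) + (\<Sum>i'\<in>{..<M\<^sub>1} - {i}. A3 j (g i) (g i'))))"
      by (intro sum_mono mult_left_mono \<Omega>0 union[OF m ij])
    also have "\<dots> = (\<Sum>g\<in>{..<M\<^sub>1} \<rightarrow>\<^sub>E C. \<Omega> g * A1 j (g i)) +
        (\<Sum>j'\<in>{..<M\<^sub>2} - {j}. \<Sum>g\<in>{..<M\<^sub>1} \<rightarrow>\<^sub>E C. \<Omega> g * A2 j j' (g i)) +
        (\<Sum>i'\<in>{..<M\<^sub>1} - {i}. \<Sum>g\<in>{..<M\<^sub>1} \<rightarrow>\<^sub>E C. \<Omega> g * A3 j (g i) (g i'))"
      unfolding distrib_left sum.distrib
      by (intro arg_cong2[where f = "(+)"] refl; subst sum.swap; simp only: sum_distrib_left)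
    also have "\<dots> \<le> e1 + (\<Sum>j'\<in>{..<M\<^sub>2} - {j}. e2) + (\<Sum>i'\<in>{..<M\<^sub>1} - {i}. e3)"
    proof (intro add_mono sum_mono)
      show "(\<Sum>g\<in>{..<M\<^sub>1} \<rightarrow>\<^sub>E C. \<Omega> g * A1 j (g i)) \<le> e1"
        unfolding \<Omega>_def using i E1[OF j] by (subst sum_PiE_coord1) (auto simp: finC \<omega>1)
      show "(\<Sum>g\<in>{..<M\<^sub>1} \<rightarrow>\<^sub>E C. \<Omega> g * A2 j j' (g i)) \<le> e2" if "j' \<in> {..<M\<^sub>2} - {j}" for j'
        unfolding \<Omega>_def using that i E2[OF j, of j'] by (subst sum_PiE_coord1) (auto simp: finC \<omega>1)
      show "(\<Sum>g\<in>{..<M\<^sub>1} \<rightarrow>\<^sub>E C. \<Omega> g * A3 j (g i) (g i')) \<le> e3" if "i' \<in> {..<M\<^sub>1} - {i}" for i'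
        unfolding \<Omega>_def using that i E3[OF j] by (subst sum_PiE_coord2) (auto simp: finC \<omega>1)
    qed
    \<comment> \<open>Each sum omits the index of the transmitted word, whence the two subtracted
      ones.\<close>
    also have "\<dots> = ?b" using i j M1 M2 by (simp add: of_nat_diff)
    finally show ?thesis .
  qed
  have "(\<Sum>g\<in>{..<M\<^sub>1} \<rightarrow>\<^sub>E C. \<Omega> g * ((\<Sum>m<M. err g m) / real M)) = (\<Sum>m<M. \<Sum>g\<in>{..<M\<^sub>1} \<rightarrow>\<^sub>E C. \<Omega> g * err g m) / real M"
    by (subst sum.swap) (simp add: sum_distrib_left sum_divide_distrib)
  also have "\<dots> \<le> (\<Sum>m<M. ?b) / real M" by (intro divide_right_mono sum_mono Eerr) auto
  also have "\<dots> = ?b" using M by simp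
  finally obtain g where "(\<Sum>m<M. err g m) / real M \<le> ?b"
    by (rule weighted_average_le[rotated 3]) (auto intro: \<Omega>0 \<Omega>1 finite_PiE finC)
  then show ?thesis by (intro that[of "\<lambda>i. fst (g i)" "\<lambda>i. snd (g i)"]) (simp add: err_def)
qed

text \<open>Sequences of pairs against pairs of sequences. The pairing
  \<open>\<lambda>t. (x t, y t)\<close> is not extensional outside \<open>{..<n}\<close>, so
  \<open>F\<close> must depend on the first \<open>n\<close> entries only.\<close>

lemma sum_seqs_pair:
  fixes F :: "(nat \<Rightarrow> 'a::finite \<times> 'b::finite) \<Rightarrow> real"
  assumes F: "\<And>z z'. (\<And>t. t < n \<Longrightarrow> z t = z' t) \<Longrightarrow> F z = F z'"
  shows "(\<Sum>z\<in>seqs n. F z) = (\<Sum>x\<in>seqs n. \<Sum>y\<in>seqs n. F (\<lambda>t. (x t, y t)))"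
proof -
  let ?r = "\<lambda>h. restrict h {..<n}"
  have "(\<Sum>x\<in>seqs n. \<Sum>y\<in>seqs n. F (\<lambda>t. (x t, y t))) =
      (\<Sum>(x, y)\<in>seqs n \<times> seqs n. F (\<lambda>t. (x t, y t)))"
    by (rule sum.cartesian_product)
  also have "\<dots> = (\<Sum>z\<in>seqs n. F z)"
  proof (rule sum.reindex_bij_witness[where j = "\<lambda>(x, y). ?r (\<lambda>t. (x t, y t))"
        and i = "\<lambda>z. (?r (\<lambda>t. fst (z t)), ?r (\<lambda>t. snd (z t)))"])
    fix p :: "(nat \<Rightarrow> 'a) \<times> (nat \<Rightarrow> 'b)" assume p: "p \<in> seqs n \<times> seqs n"
    obtain x y where xy: "p = (x, y)" by (cases p)
    have r: "x \<in> seqs n" "y \<in> seqs n" using p xy by auto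
    show "(case p of (x, y) \<Rightarrow> ?r (\<lambda>t. (x t, y t))) \<in> seqs n" by (simp add: xy)
    have "?r (\<lambda>t. fst (?r (\<lambda>t. (x t, y t)) t)) = x" "?r (\<lambda>t. snd (?r (\<lambda>t. (x t, y t)) t)) = y"
      using r by (auto intro!: extensionalityI[of _ "{..<n}"] simp: PiE_def)
    then show "(?r (\<lambda>t. fst ((case p of (x, y) \<Rightarrow> ?r (\<lambda>t. (x t, y t))) t)),
        ?r (\<lambda>t. snd ((case p of (x, y) \<Rightarrow> ?r (\<lambda>t. (x t, y t))) t))) = p"
      by (simp add: xy)
    have "F (?r (\<lambda>t. (x t, y t))) = F (\<lambda>t. (x t, y t))" by (rule F) simp
    then show "F (case p of (x, y) \<Rightarrow> ?r (\<lambda>t. (x t, y t))) = (case p of (x, y) \<Rightarrow> F (\<lambda>t. (x t, y t)))"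
      by (simp add: xy)
  next
    fix z :: "nat \<Rightarrow> 'a \<times> 'b" assume "z \<in> seqs n"
    then have "?r (\<lambda>t. (?r (\<lambda>t. fst (z t)) t, ?r (\<lambda>t. snd (z t)) t)) = z"
      by (auto intro!: extensionalityI[of _ "{..<n}"] simp: PiE_def)
    then show "(case (?r (\<lambda>t. fst (z t)), ?r (\<lambda>t. snd (z t))) of (x, y) \<Rightarrow> ?r (\<lambda>t. (x t, y t))) = z"
      by simp
    show "(?r (\<lambda>t. fst (z t)), ?r (\<lambda>t. snd (z t))) \<in> seqs n \<times> seqs n" by simp
  qed
  finally show ?thesis ..
qed

section \<open>Probability that a random codeword has a given joint type\<close>

lemma sum_of_bool: "finite A \<Longrightarrow> (\<Sum>a\<in>A. f a * of_bool (Q a)) = (\<Sum>a\<in>{a\<in>A. Q a}. f a :: real)"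
  by (simp add: of_bool_def if_distrib[of "\<lambda>x. _ * x"] sum.If_cases Int_def cong: if_cong)

text \<open>Size of the conditional type class times the largest probability of a member,
  \<open>2 powr (- n h)\<close>.\<close>

lemma sum_type_prob_le:
  fixes \<iota> :: "'u::finite \<Rightarrow> 'w::finite \<Rightarrow> 'z::finite"
  assumes \<iota>: "\<And>u w. \<pi> (\<iota> u w) = w" "\<And>u u' w. \<iota> u w = \<iota> u' w \<Longrightarrow> u = u'" and n: "0 < n"
    and p: "\<And>u. emp n (\<lambda>t. \<iota> (u t) (w t)) = f \<Longrightarrow> p u \<le> 2 powr (- (real n * h))"
  shows "(\<Sum>u\<in>seqs n. p u * of_bool (emp n (\<lambda>t. \<iota> (u t) (w t)) = f))
    \<le> 2 powr (- (real n * (h + entropy (marg \<pi> f) - entropy f)))"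
proof -
  let ?U = "{u \<in> seqs n. emp n (\<lambda>t. \<iota> (u t) (w t)) = f}"
  have "(\<Sum>u\<in>seqs n. p u * of_bool (emp n (\<lambda>t. \<iota> (u t) (w t)) = f)) = (\<Sum>u\<in>?U. p u)"
    by (rule sum_of_bool[OF finite_seqs])
  also have "\<dots> \<le> real (card ?U) * 2 powr (- (real n * h))"
    by (intro sum_bounded_above p) simp
  also have "\<dots> \<le> 2 powr (real n * (entropy f - entropy (marg \<pi> f))) * 2 powr (- (real n * h))"
    by (intro mult_right_mono card_type_le[of \<pi> \<iota>, OF \<iota> n]) auto
  also have "\<dots> = 2 powr (- (real n * (h + entropy (marg \<pi> f) - entropy f)))"
    by (simp add: powr_add[symmetric] algebra_simps)
  finally show ?thesis .
qed

lemma emp_marginals: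
  "m12 (emp n (\<lambda>t. (u t, v t, y t))) = emp n (\<lambda>t. (u t, v t))"
  "m1y (emp n (\<lambda>t. (u t, v t, y t))) = emp n (\<lambda>t. (u t, y t))"
  "m1 (emp n (\<lambda>t. (u t, v t, y t))) = emp n u"
  "my (emp n (\<lambda>t. (u t, v t, y t))) = emp n y"
  by (simp_all add: marginals marg_emp)

lemma cloud_type_prob_le:
  fixes f :: "('a::finite, 'b::finite, 'y::finite) jdist"
  assumes p: "is_dist p" and n: "0 < n"
  shows "(\<Sum>u\<in>seqs n. iid p n u * of_bool (emp n (\<lambda>t. (u t, y t)) = m1y f)) \<le> 2 powr (- (real n * MI_1_Y f))"
proof -
  have m: "m1 f = marg fst (m1y f)" "my f = marg snd (m1y f)"
    by (simp_all add: marginals marg_marg case_prod_unfold)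
  have "(\<Sum>u\<in>seqs n. iid p n u * of_bool (emp n (\<lambda>t. (u t, y t)) = m1y f))
      \<le> 2 powr (- (real n * (entropy (m1 f) + entropy (marg snd (m1y f)) - entropy (m1y f))))"
  proof (rule sum_type_prob_le[where \<iota> = Pair])
    fix u assume u: "emp n (\<lambda>t. (u t, y t)) = m1y f"
    \<comment> \<open>Projecting onto \<open>unit\<close> turns the conditional entropy of
      \<open>prod_kernel_le\<close> into the plain entropy of the type of \<open>u\<close>.\<close>
    have "(\<Prod>t<n. p (u t)) \<le> 2 powr (- (real n * (entropy (emp n u) - entropy (emp n (\<lambda>t. (\<lambda>_. ()) (u t))))))"
      by (rule prod_kernel_le[OF _ _ n]) (use p in \<open>auto simp: is_dist_def\<close>)
    also have "entropy (emp n (\<lambda>t. (\<lambda>_. ()) (u t))) = 0" by (rule entropy_unit[OF is_dist_emp[OF n]])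
    also have "emp n u = m1 f" unfolding m u[symmetric] marg_emp by simp
    finally show "iid p n u \<le> 2 powr (- (real n * entropy (m1 f)))" by (simp add: iid_def)
  qed (auto simp: n)
  then show ?thesis by (simp add: MI_1_Y_def m)
qed

text \<open>The kernel contributes H(X2|X1) of \<open>f\<close> to the exponent, and the type class
  given (\<open>X1\<close>, \<open>Y\<close>) removes H(X2|X1,Y); what remains is
  I(X2;Y|X1).\<close>

lemma satellite_type_prob_le:
  fixes f :: "('a::finite, 'b::finite, 'y::finite) jdist"
  assumes k: "\<And>a b. 0 \<le> k a b" "\<And>a. (\<Sum>b\<in>UNIV. k a b) \<le> 1" and n: "0 < n"
  shows "(\<Sum>v\<in>seqs n. (\<Prod>t<n. k (u t) (v t)) * of_bool (emp n (\<lambda>t. (u t, v t, y t)) = f))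
    \<le> 2 powr (- (real n * MI_2_Y_given_1 f))"
proof -
  have "(\<Sum>v\<in>seqs n. (\<Prod>t<n. k (u t) (v t)) * of_bool (emp n (\<lambda>t. (\<lambda>b (a, y). (a, b, y)) (v t) (u t, y t)) = f))
    \<le> 2 powr (- (real n * ((entropy (m12 f) - entropy (m1 f)) + entropy (marg (\<lambda>(a, b, y). (a, y)) f) - entropy f)))"
  proof (rule sum_type_prob_le[where w = "\<lambda>t. (u t, y t)"])
    fix v assume v: "emp n (\<lambda>t. (\<lambda>b (a, y). (a, b, y)) (v t) (u t, y t)) = f"
    have r: "{z :: 'a \<times> 'b. fst z = a} = range (Pair a)" for a by auto
    have "(\<Prod>t<n. case_prod k (u t, v t)) \<le>
        2 powr (- (real n * (entropy (emp n (\<lambda>t. (u t, v t))) - entropy (emp n (\<lambda>t. fst (u t, v t))))))"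
      by (rule prod_kernel_le[OF _ _ n]) (auto simp: k r sum.reindex inj_on_def)
    also have "emp n (\<lambda>t. (u t, v t)) = m12 f" unfolding v[symmetric] by (simp add: emp_marginals)
    also have "emp n (\<lambda>t. fst (u t, v t)) = m1 f" unfolding v[symmetric] by (simp add: emp_marginals)
    finally show "(\<Prod>t<n. k (u t) (v t)) \<le> 2 powr (- (real n * (entropy (m12 f) - entropy (m1 f))))" by simp
  qed (auto simp: n)
  then show ?thesis by (simp add: MI_2_Y_given_1_def marginals algebra_simps)
qed

text \<open>Moves the truncation at 1 inside the sum over joint types: if some \<open>a i\<close>
  exceeds 1, its \<open>b i\<close> alone is at least 1.\<close>

lemma min_1_sum_le:
  fixes a b :: "'i \<Rightarrow> real"
  assumes "finite A" "\<And>i. i \<in> A \<Longrightarrow> 0 \<le> b i" "\<And>i. i \<in> A \<Longrightarrow> min 1 (a i) \<le> b i"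
  shows "min 1 (\<Sum>i\<in>A. a i) \<le> (\<Sum>i\<in>A. b i)"
proof (cases "\<exists>i\<in>A. 1 < a i")
  case True
  then obtain i where i: "i \<in> A" "1 < a i" by blast
  then have "1 \<le> b i" using assms(3)[OF i(1)] by (simp add: min_def split: if_splits)
  also have "b i \<le> sum b A" using i assms by (intro member_le_sum) auto
  finally show ?thesis by simp
next
  case False
  then have "sum a A \<le> sum b A" using assms(3) by (intro sum_mono) (fastforce simp: not_less min_absorb2)
  then show ?thesis by simp
qed

section \<open>Stability of the metric, and the error of superposition coding at fixed
  length\<close>

lemma expect_metric_alt: "expect_metric f qt = (\<Sum>z\<in>UNIV. f z * (case z of (a, b, y) \<Rightarrow> qt a b y))"
  by (simp add: expect_metric_def case_prod_unfold)

lemma expect_metric_emp: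
  "expect_metric (emp n (\<lambda>t. (u t, v t, y t))) qt = (\<Sum>t<n. qt (u t) (v t) (y t)) / real n"
  unfolding expect_metric_alt sum_emp by simp

text \<open>A crude Lipschitz constant of \<open>expect_metric\<close> in the \<open>l1\<close>
  distance: the sum dominates the largest absolute value of the metric.\<close>

definition metric_norm :: "('a1::finite \<Rightarrow> 'a2::finite \<Rightarrow> 'y::finite \<Rightarrow> real) \<Rightarrow> real" where
  "metric_norm qt = (\<Sum>(a, b, y)\<in>UNIV. \<bar>qt a b y\<bar>)"

lemma metric_norm_nonneg: "0 \<le> metric_norm qt"
  unfolding metric_norm_def by (intro sum_nonneg) auto

lemma expect_metric_diff_le: "expect_metric P qt - metric_norm qt * l1 f P \<le> expect_metric f qt"
proof -
  have "expect_metric P qt - expect_metric f qt \<le> (\<Sum>z\<in>UNIV. \<bar>f z - P z\<bar> * metric_norm qt)"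
    unfolding expect_metric_alt sum_subtractf[symmetric]
  proof (rule sum_mono)
    fix z :: "'a \<times> 'b \<times> 'c"
    let ?q = "case z of (a, b, y) \<Rightarrow> qt a b y"
    have "\<bar>?q\<bar> \<le> metric_norm qt"
      unfolding metric_norm_def using member_le_sum[of z UNIV "\<lambda>(a, b, y). \<bar>qt a b y\<bar>"]
      by (auto simp: case_prod_unfold)
    then have "\<bar>f z - P z\<bar> * \<bar>?q\<bar> \<le> \<bar>f z - P z\<bar> * metric_norm qt" by (intro mult_left_mono) auto
    moreover have "(P z - f z) * ?q \<le> \<bar>f z - P z\<bar> * \<bar>?q\<bar>"
      using abs_ge_self[of "(P z - f z) * ?q"] unfolding abs_mult abs_minus_commute[of "P z"] .
    ultimately show "P z * ?q - f z * ?q \<le> \<bar>f z - P z\<bar> * metric_norm qt"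
      by (simp add: left_diff_distrib)
  qed
  also have "\<dots> = metric_norm qt * l1 f P"
    unfolding l1_def sum_distrib_right[symmetric] by (rule mult.commute)
  finally show ?thesis by linarith
qed

lemma induced_dist_m12:
  fixes PX :: "'a::finite \<times> 'b::finite \<Rightarrow> real"
  assumes "is_channel W" shows "m12 (induced_dist PX W \<phi>) = PX"
proof
  fix z :: "'a \<times> 'b"
  obtain a b where z: "z = (a, b)" by (cases z)
  have "(\<Sum>y\<in>UNIV. W (\<phi> a b) y) = 1" using assms by (simp add: is_channel_def is_dist_def)
  then show "m12 (induced_dist PX W \<phi>) z = PX z"
    by (simp add: z m12_def induced_dist_def sum_distrib_left[symmetric])
qed

lemma is_dist_induced:
  assumes "is_channel W" "is_dist PX" shows "is_dist (induced_dist PX W \<phi>)"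
proof -
  have "(\<Sum>z\<in>UNIV. induced_dist PX W \<phi> z) = (\<Sum>z\<in>UNIV. m12 (induced_dist PX W \<phi>) z)"
    using sum_marg[of "\<lambda>(a, b, y). (a, b)" "induced_dist PX W \<phi>" "\<lambda>_. 1"] by (simp add: marginals)
  moreover have "0 \<le> induced_dist PX W \<phi> (a, b, y)" for a b y
    using assms by (simp add: induced_dist_def is_channel_def is_dist_def)
  ultimately show ?thesis using assms(2) unfolding induced_dist_m12[OF assms(1)] is_dist_def
    by (metis surj_pair)
qed

text \<open>Origin of the constants: conditioning costs at most a factor 4 for centres and 2 for
  satellites, whence 8 in the atypicality term and 2 in the term of the own cloud. In the last term,
  16 is 4 for centres, 2 for satellites and 2 from the bound on \<open>M\<^sub>2\<close>. Slack
  \<open>metric_norm qt * \<eta>\<close> enters \<open>h1\<close> and \<open>h2\<close> because the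
  metric of a typical transmitted word may fall that far below its mean.\<close>

lemma superposition_error_bound:
  fixes W :: "'x::finite \<Rightarrow> 'y::finite \<Rightarrow> real" and q :: "'x \<Rightarrow> 'y \<Rightarrow> real"
    and PX :: "'a1::finite \<times> 'a2::finite \<Rightarrow> real" and \<phi> :: "'a1 \<Rightarrow> 'a2 \<Rightarrow> 'x"
    and n M M\<^sub>1 M\<^sub>2 :: nat
  defines "P \<equiv> induced_dist PX W \<phi>" and "qt \<equiv> induced_metric q \<phi>"
  assumes W: "is_channel W" and PX: "is_dist PX" and n: "0 < n" and \<eta>: "0 < \<eta>"
    and large: "4 * (real CARD('a1 \<times> 'a2))\<^sup>2 \<le> \<eta>\<^sup>2 * real n"
    and h2: "\<And>f. is_dist f \<Longrightarrow> l1 (m12 f) (m12 P) \<le> \<eta> \<Longrightarrow> l1 (m1y f) (m1y P) \<le> \<eta> \<Longrightarrow>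
        expect_metric P qt - metric_norm qt * \<eta> \<le> expect_metric f qt \<Longrightarrow> \<rho>\<^sub>2 \<le> MI_2_Y_given_1 f"
    and h1: "\<And>f. is_dist f \<Longrightarrow> l1 (m12 f) (m12 P) \<le> \<eta> \<Longrightarrow> l1 (my f) (my P) \<le> \<eta> \<Longrightarrow>
        expect_metric P qt - metric_norm qt * \<eta> \<le> expect_metric f qt \<Longrightarrow>
        \<rho>\<^sub>1 \<le> MI_1_Y f + pos_part (MI_2_Y_given_1 f - r\<^sub>2)"
    and M2: "real M\<^sub>2 \<le> 2 * 2 powr (real n * r\<^sub>2)" and M: "0 < M" "M \<le> M\<^sub>1 * M\<^sub>2"
  shows "\<exists>C. avg_error_prob W q n M C \<le>
      8 * (real CARD('a1 \<times> 'a2 \<times> 'y))\<^sup>2 / (\<eta>\<^sup>2 * real n)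
      + (real M\<^sub>2 - 1) * (2 * real ((n + 1) ^ CARD('a1 \<times> 'a2 \<times> 'y)) * 2 powr (- (real n * \<rho>\<^sub>2)))
      + (real M\<^sub>1 - 1) * (16 * real ((n + 1) ^ CARD('a1 \<times> 'a2 \<times> 'y)) * 2 powr (- (real n * \<rho>\<^sub>1)))"
proof -
  let ?N = "real ((n + 1) ^ CARD('a1 \<times> 'a2 \<times> 'y))"
  have P: "is_dist P" and P12: "m12 P = PX"
    unfolding P_def by (rule is_dist_induced[OF W PX], rule induced_dist_m12[OF W])
  define p1 where "p1 = marg fst PX"
  define k where "k a b = PX (a, b) / p1 a" for a b
  have p1: "is_dist p1" unfolding p1_def by (rule is_dist_marg[OF PX])
  have p10: "0 \<le> p1 a" for a by (rule is_dist_nonneg[OF p1])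
  have k0: "0 \<le> k a b" for a b
    unfolding k_def using is_dist_nonneg[OF PX] p10 by (intro divide_nonneg_nonneg) auto
  have k1: "(\<Sum>b\<in>UNIV. k a b) \<le> 1" for a
  proof -
    have r: "{z :: 'a1 \<times> 'a2. fst z = a} = range (Pair a)" by auto
    show ?thesis using cond_sum_le_1[OF PX, of fst a]
      unfolding r by (simp add: k_def p1_def sum.reindex inj_on_def)
  qed
  \<comment> \<open>Where \<open>p1 a = 0\<close>, \<open>PX (a, b)\<close> is squeezed to 0 as
    well, so the factorisation survives division by zero.\<close>
  have pk: "PX (a, b) = p1 a * k a b" for a b
    using le_marg[OF PX, of "(a, b)" fst] is_dist_nonneg[OF PX, of "(a, b)"]
    by (simp add: k_def p1_def)
  have W0: "0 \<le> W x y" and W1: "(\<Sum>y\<in>UNIV. W x y) = 1" for x y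
    using W by (auto simp: is_channel_def is_dist_def)
  define kn where "kn u v = (\<Prod>t<n. k (u t) (v t))" for u :: "nat \<Rightarrow> 'a1" and v
  define K where "K u v y = (\<Prod>t<n. W (\<phi> (u t) (v t)) (y t))" for u v and y :: "nat \<Rightarrow> 'y"
  have kn0: "0 \<le> kn u v" for u v unfolding kn_def by (intro prod_nonneg ballI k0)
  have p1n0: "0 \<le> iid p1 n u" for u by (rule iid_nonneg[OF p10])
  have K0: "0 \<le> K u v y" for u v y unfolding K_def by (intro prod_nonneg ballI W0)
  have K1: "(\<Sum>y\<in>seqs n. K u v y) \<le> 1" for u v
    unfolding K_def by (subst prod_sum_PiE[symmetric]) (auto simp: W1)
  have kn1: "(\<Sum>v\<in>seqs n. kn u v) \<le> 1" for u
    unfolding kn_def by (subst prod_sum_PiE[symmetric]) (auto intro!: prod_le_1 sum_nonneg k0 k1)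
  have PXn: "iid PX n (\<lambda>t. (u t, v t)) = iid p1 n u * kn u v" for u v
    by (simp add: iid_def kn_def pk prod.distrib)
  have Pn: "iid P n (\<lambda>t. (u t, v t, y t)) = iid p1 n u * kn u v * K u v y" for u v y
    by (simp add: iid_def kn_def K_def P_def induced_dist_def pk prod.distrib)

  define T where "T u = {v \<in> seqs n. l1 (emp n (\<lambda>t. (u t, v t))) PX \<le> \<eta>}" for u
  define \<kappa> where "\<kappa> u = (\<Sum>v\<in>T u. kn u v)" for u
  \<comment> \<open>Centres outside \<open>S\<close> are discarded so that normalising by
    \<open>\<kappa> u\<close> costs at most a factor 2.\<close>
  define S where "S = {u \<in> seqs n. 1 / 2 \<le> \<kappa> u}"
  define Z where "Z = (\<Sum>u\<in>S. iid p1 n u)"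
  define \<mu>\<^sub>1 where "\<mu>\<^sub>1 u = iid p1 n u / Z" for u
  define \<mu>\<^sub>2 where "\<mu>\<^sub>2 u v = kn u v / \<kappa> u" for u v
  have Tsub: "T u \<subseteq> seqs n" and Ssub: "S \<subseteq> seqs n" for u by (auto simp: T_def S_def)
  have finT: "finite (T u)" and finS: "finite S" for u
    using finite_subset[OF Tsub finite_seqs] finite_subset[OF Ssub finite_seqs] by auto
  have \<kappa>0: "0 \<le> \<kappa> u" for u unfolding \<kappa>_def by (intro sum_nonneg kn0)
  have \<kappa>1: "\<kappa> u \<le> 1" for u
  proof -
    have "\<kappa> u \<le> (\<Sum>v\<in>seqs n. kn u v)" unfolding \<kappa>_def by (intro sum_mono2 finite_seqs Tsub kn0)
    then show ?thesis using kn1[of u] by linarith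
  qed
  \<comment> \<open>By \<open>large\<close> a pair is typical with probability at least 3/4. This
    probability is the mean of \<open>\<kappa>\<close>, which is at most 1 on \<open>S\<close> and
    below 1/2 elsewhere, hence at most \<open>Z + 1 / 2\<close>.\<close>
  have Z: "1 / 4 \<le> Z"
  proof -
    have "(\<Sum>z\<in>seqs n. iid PX n z * of_bool (\<eta> < l1 (emp n z) PX)) \<le> (real CARD('a1 \<times> 'a2))\<^sup>2 / (\<eta>\<^sup>2 * real n)"
      by (rule type_concentration[OF PX n \<eta>])
    also have "\<dots> \<le> 1 / 4" using large \<eta> n by (simp add: field_simps)
    finally have "3 / 4 \<le> (\<Sum>z\<in>seqs n. iid PX n z) - (\<Sum>z\<in>seqs n. iid PX n z * of_bool (\<eta> < l1 (emp n z) PX))"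
      using sum_PiE_total[of "{..<n}" UNIV PX] PX by (simp add: iid_def is_dist_def)
    also have "\<dots> = (\<Sum>z\<in>seqs n. iid PX n z * of_bool (l1 (emp n z) PX \<le> \<eta>))"
      unfolding sum_subtractf[symmetric] by (intro sum.cong) (auto simp: not_less)
    also have "\<dots> = (\<Sum>u\<in>seqs n. \<Sum>v\<in>seqs n. iid PX n (\<lambda>t. (u t, v t)) * of_bool (l1 (emp n (\<lambda>t. (u t, v t))) PX \<le> \<eta>))"
    proof (rule sum_seqs_pair)
      fix z z' :: "nat \<Rightarrow> 'a1 \<times> 'a2" assume "\<And>t. t < n \<Longrightarrow> z t = z' t"
      then show "iid PX n z * of_bool (l1 (emp n z) PX \<le> \<eta>) = iid PX n z' * of_bool (l1 (emp n z') PX \<le> \<eta>)"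
        by (simp add: iid_def emp_cong[of n z z'])
    qed
    also have "\<dots> = (\<Sum>u\<in>seqs n. iid p1 n u * \<kappa> u)"
    proof (rule sum.cong[OF refl])
      fix u
      show "(\<Sum>v\<in>seqs n. iid PX n (\<lambda>t. (u t, v t)) * of_bool (l1 (emp n (\<lambda>t. (u t, v t))) PX \<le> \<eta>)) = iid p1 n u * \<kappa> u"
        unfolding sum_of_bool[OF finite_seqs] PXn \<kappa>_def T_def sum_distrib_left ..
    qed
    also have "\<dots> \<le> (\<Sum>u\<in>seqs n. iid p1 n u * of_bool (u \<in> S) + iid p1 n u * (1 / 2))"
    proof (rule sum_mono)
      fix u :: "nat \<Rightarrow> 'a1" assume "u \<in> seqs n"
      then have "\<kappa> u \<le> of_bool (u \<in> S) + 1 / 2" using \<kappa>1[of u] by (auto simp: S_def of_bool_def)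
      then have "iid p1 n u * \<kappa> u \<le> iid p1 n u * (of_bool (u \<in> S) + 1 / 2)"
        by (rule mult_left_mono[OF _ p1n0])
      then show "iid p1 n u * \<kappa> u \<le> iid p1 n u * of_bool (u \<in> S) + iid p1 n u * (1 / 2)"
        by (simp only: distrib_left)
    qed
    also have "\<dots> = Z + 1 / 2"
    proof -
      have "(\<Sum>u\<in>seqs n. iid p1 n u) = 1"
        unfolding iid_def using p1 by (intro sum_PiE_total) (auto simp: is_dist_def)
      moreover have "{u \<in> seqs n. u \<in> S} = S" using Ssub by auto
      ultimately show ?thesis
        unfolding sum.distrib sum_of_bool[OF finite_seqs] sum_distrib_right[symmetric] by (simp add: Z_def)
    qed
    finally show ?thesis by simp
  qed
  have \<mu>1_le: "\<mu>\<^sub>1 u \<le> 4 * iid p1 n u" for u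
  proof -
    have "iid p1 n u / Z \<le> iid p1 n u / (1 / 4)"
      using Z p1n0 by (intro divide_left_mono) auto
    then show ?thesis by (simp add: \<mu>\<^sub>1_def)
  qed
  have \<mu>2_le: "\<mu>\<^sub>2 u v \<le> 2 * kn u v" if "u \<in> S" for u v
  proof -
    have "kn u v / \<kappa> u \<le> kn u v / (1 / 2)"
      using that kn0 by (intro divide_left_mono) (auto simp: S_def)
    then show ?thesis by (simp add: \<mu>\<^sub>2_def)
  qed
  have \<mu>10: "0 \<le> \<mu>\<^sub>1 u" for u using Z p1n0 by (simp add: \<mu>\<^sub>1_def)
  have \<mu>20: "0 \<le> \<mu>\<^sub>2 u v" for u v using \<kappa>0 kn0 by (simp add: \<mu>\<^sub>2_def)

  define G where "G u v y \<longleftrightarrow> l1 (emp n (\<lambda>t. (u t, v t, y t))) P \<le> \<eta>" for u v y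
  define B where "B u v y \<longleftrightarrow> expect_metric P qt - metric_norm qt * \<eta> \<le> expect_metric (emp n (\<lambda>t. (u t, v t, y t))) qt"
    for u v y

  have e1: "(\<Sum>u\<in>S. \<mu>\<^sub>1 u * (\<Sum>v\<in>T u. \<mu>\<^sub>2 u v * (\<Sum>y\<in>seqs n. K u v y * of_bool (\<not> G u v y))))
      \<le> 8 * (real CARD('a1 \<times> 'a2 \<times> 'y))\<^sup>2 / (\<eta>\<^sup>2 * real n)"
  proof -
    define X where "X u v = (\<Sum>y\<in>seqs n. K u v y * of_bool (\<not> G u v y))" for u v
    have X0: "0 \<le> X u v" for u v unfolding X_def by (intro sum_nonneg mult_nonneg_nonneg K0) simp
    have "(\<Sum>u\<in>S. \<mu>\<^sub>1 u * (\<Sum>v\<in>T u. \<mu>\<^sub>2 u v * X u v)) \<le>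
        (\<Sum>u\<in>S. (4 * iid p1 n u) * (\<Sum>v\<in>T u. (2 * kn u v) * X u v))"
      by (intro sum_mono mult_mono \<mu>1_le mult_right_mono \<mu>2_le X0 sum_nonneg mult_nonneg_nonneg \<mu>20)
        (auto simp: p1n0)
    also have "\<dots> \<le> (\<Sum>u\<in>seqs n. (4 * iid p1 n u) * (\<Sum>v\<in>seqs n. (2 * kn u v) * X u v))"
    proof -
      have "(\<Sum>u\<in>S. (4 * iid p1 n u) * (\<Sum>v\<in>T u. (2 * kn u v) * X u v)) \<le>
          (\<Sum>u\<in>S. (4 * iid p1 n u) * (\<Sum>v\<in>seqs n. (2 * kn u v) * X u v))"
        by (intro sum_mono mult_left_mono sum_mono2 finite_seqs Tsub) (auto simp: p1n0 kn0 X0)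
      also have "\<dots> \<le> (\<Sum>u\<in>seqs n. (4 * iid p1 n u) * (\<Sum>v\<in>seqs n. (2 * kn u v) * X u v))"
        by (intro sum_mono2 finite_seqs Ssub mult_nonneg_nonneg sum_nonneg) (auto simp: p1n0 kn0 X0)
      finally show ?thesis .
    qed
    also have "\<dots> = 8 * (\<Sum>u\<in>seqs n. \<Sum>v\<in>seqs n. \<Sum>y\<in>seqs n. iid P n (\<lambda>t. (u t, v t, y t)) * of_bool (\<not> G u v y))"
      unfolding X_def Pn by (simp add: sum_distrib_left mult_ac)
    also have "(\<Sum>u\<in>seqs n. \<Sum>v\<in>seqs n. \<Sum>y\<in>seqs n. iid P n (\<lambda>t. (u t, v t, y t)) * of_bool (\<not> G u v y)) =
        (\<Sum>u\<in>seqs n. \<Sum>w\<in>seqs n. iid P n (\<lambda>t. (u t, w t)) * of_bool (\<eta> < l1 (emp n (\<lambda>t. (u t, w t))) P))"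
    proof (rule sum.cong[OF refl])
      fix u
      show "(\<Sum>v\<in>seqs n. \<Sum>y\<in>seqs n. iid P n (\<lambda>t. (u t, v t, y t)) * of_bool (\<not> G u v y)) =
        (\<Sum>w\<in>seqs n. iid P n (\<lambda>t. (u t, w t)) * of_bool (\<eta> < l1 (emp n (\<lambda>t. (u t, w t))) P))"
      proof (subst sum_seqs_pair)
        fix z z' :: "nat \<Rightarrow> 'a2 \<times> 'y" assume "\<And>t. t < n \<Longrightarrow> z t = z' t"
        then show "iid P n (\<lambda>t. (u t, z t)) * of_bool (\<eta> < l1 (emp n (\<lambda>t. (u t, z t))) P) =
            iid P n (\<lambda>t. (u t, z' t)) * of_bool (\<eta> < l1 (emp n (\<lambda>t. (u t, z' t))) P)"
          by (simp add: iid_def emp_cong[of n "\<lambda>t. (u t, z t)" "\<lambda>t. (u t, z' t)"])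
      qed (simp add: G_def not_le)
    qed
    also have "\<dots> = (\<Sum>z\<in>seqs n. iid P n z * of_bool (\<eta> < l1 (emp n z) P))"
    proof (rule sum_seqs_pair[symmetric])
      fix z z' :: "nat \<Rightarrow> 'a1 \<times> 'a2 \<times> 'y" assume "\<And>t. t < n \<Longrightarrow> z t = z' t"
      then show "iid P n z * of_bool (\<eta> < l1 (emp n z) P) = iid P n z' * of_bool (\<eta> < l1 (emp n z') P)"
        by (simp add: iid_def emp_cong[of n z z'])
    qed
    also have "8 * \<dots> \<le> 8 * ((real CARD('a1 \<times> 'a2 \<times> 'y))\<^sup>2 / (\<eta>\<^sup>2 * real n))"
      by (intro mult_left_mono type_concentration[OF P n \<eta>]) simp
    finally show ?thesis by (simp add: X_def)
  qed

  let ?F = "range (emp n :: (nat \<Rightarrow> 'a1 \<times> 'a2 \<times> 'y) \<Rightarrow> _)"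
  have finF: "finite ?F" and cardF: "real (card ?F) \<le> ?N"
    using range_emp[of n, where 'c = "'a1 \<times> 'a2 \<times> 'y"] by (auto simp only: of_nat_le_iff)
  \<comment> \<open>A union bound over joint types. The indicator that (\<open>u\<close>,
    \<open>y\<close>) has type \<open>m1y f\<close> is kept for \<open>e3\<close>, where averaging
    over the centre turns it into a factor governed by I(X1;Y); in \<open>e2\<close> the centre is
    fixed and it is bounded by 1.\<close>
  have sat: "(\<Sum>v\<in>T u. \<mu>\<^sub>2 u v * of_bool (B u v y)) \<le>
      (\<Sum>f\<in>F. of_bool (emp n (\<lambda>t. (u t, y t)) = m1y f) * (2 * 2 powr (- (real n * MI_2_Y_given_1 f))))"
    if u: "u \<in> S" and F: "F \<subseteq> ?F" and mem: "\<And>v. v \<in> T u \<Longrightarrow> B u v y \<Longrightarrow> emp n (\<lambda>t. (u t, v t, y t)) \<in> F" for u y F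
  proof -
    have fF: "finite F" by (rule finite_subset[OF F finF])
    have ob: "of_bool (B u v y) \<le> (\<Sum>f\<in>F. of_bool (emp n (\<lambda>t. (u t, v t, y t)) = f) :: real)" if "v \<in> T u" for v
    proof (cases "B u v y")
      case True
      have "(\<Sum>f\<in>F. of_bool (emp n (\<lambda>t. (u t, v t, y t)) = f) :: real) = 1"
        using mem[OF that True] fF by (simp add: of_bool_def)
      then show ?thesis by simp
    qed (simp add: sum_nonneg)
    have "(\<Sum>v\<in>T u. \<mu>\<^sub>2 u v * of_bool (B u v y)) \<le>
        (\<Sum>v\<in>T u. (2 * kn u v) * (\<Sum>f\<in>F. of_bool (emp n (\<lambda>t. (u t, v t, y t)) = f)))"
      by (intro sum_mono mult_mono \<mu>2_le[OF u] ob) (auto simp: kn0)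
    also have "\<dots> \<le> (\<Sum>v\<in>seqs n. (2 * kn u v) * (\<Sum>f\<in>F. of_bool (emp n (\<lambda>t. (u t, v t, y t)) = f)))"
      by (intro sum_mono2 finite_seqs Tsub mult_nonneg_nonneg sum_nonneg) (auto simp: kn0)
    also have "\<dots> = (\<Sum>f\<in>F. 2 * (\<Sum>v\<in>seqs n. kn u v * of_bool (emp n (\<lambda>t. (u t, v t, y t)) = f)))"
      unfolding sum_distrib_left by (subst sum.swap) (simp only: mult.assoc)
    also have "\<dots> \<le> (\<Sum>f\<in>F. of_bool (emp n (\<lambda>t. (u t, y t)) = m1y f) * (2 * 2 powr (- (real n * MI_2_Y_given_1 f))))"
    proof (rule sum_mono)
      fix f assume "f \<in> F"
      show "2 * (\<Sum>v\<in>seqs n. kn u v * of_bool (emp n (\<lambda>t. (u t, v t, y t)) = f))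
        \<le> of_bool (emp n (\<lambda>t. (u t, y t)) = m1y f) * (2 * 2 powr (- (real n * MI_2_Y_given_1 f)))"
      proof (cases "emp n (\<lambda>t. (u t, y t)) = m1y f")
        case True
        then show ?thesis using satellite_type_prob_le[of k n u y f, OF k0 k1 n] by (simp add: kn_def)
      next
        case False
        then have "emp n (\<lambda>t. (u t, v t, y t)) \<noteq> f" for v using emp_marginals(2)[of n u v y] by metis
        then show ?thesis using False by simp
      qed
    qed
    finally show ?thesis .
  qed
  \<comment> \<open>A competitor in the same cloud shares \<open>u\<close> and \<open>y\<close> with
    the transmitted word, so its type inherits the bound on \<open>m1y\<close>, as in
    \<open>setL2\<close>. One from another cloud shares only \<open>y\<close> and inherits the bound
    on \<open>my\<close>, as in \<open>setL0\<close>. Nearness of \<open>m12\<close> comes from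
    membership in \<open>T\<close> in both cases.\<close>
  have Gm: "l1 (m1y (emp n (\<lambda>t. (u t, v t, y t)))) (m1y P) \<le> \<eta>" "l1 (my (emp n (\<lambda>t. (u t, v t, y t)))) (my P) \<le> \<eta>"
    if "G u v y" for u v y
    using that l1_marg[of _ "emp n (\<lambda>t. (u t, v t, y t))" P] unfolding G_def marginals by (auto intro: order_trans)

  have e2: "(\<Sum>v'\<in>T u. \<mu>\<^sub>2 u v' * of_bool (B u v' y)) \<le> 2 * ?N * 2 powr (- (real n * \<rho>\<^sub>2))"
    if u: "u \<in> S" and v: "v \<in> T u" and g: "G u v y" for u v y
  proof -
    let ?F2 = "{f \<in> ?F. \<rho>\<^sub>2 \<le> MI_2_Y_given_1 f}"
    have "(\<Sum>v'\<in>T u. \<mu>\<^sub>2 u v' * of_bool (B u v' y)) \<le>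
      (\<Sum>f\<in>?F2. of_bool (emp n (\<lambda>t. (u t, y t)) = m1y f) * (2 * 2 powr (- (real n * MI_2_Y_given_1 f))))"
    proof (rule sat[OF u])
      fix v' assume v': "v' \<in> T u" and b: "B u v' y"
      have "\<rho>\<^sub>2 \<le> MI_2_Y_given_1 (emp n (\<lambda>t. (u t, v' t, y t)))"
        using v' b Gm(1)[OF g] by (intro h2 is_dist_emp[OF n]) (auto simp: emp_marginals T_def P12 B_def)
      then show "emp n (\<lambda>t. (u t, v' t, y t)) \<in> ?F2" by auto
    qed auto
    also have "\<dots> \<le> (\<Sum>f\<in>?F2. 2 * 2 powr (- (real n * \<rho>\<^sub>2)))"
    proof (rule sum_mono)
      fix f assume "f \<in> ?F2"
      then have "2 powr (- (real n * MI_2_Y_given_1 f)) \<le> 2 powr (- (real n * \<rho>\<^sub>2))"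
        using n by (intro powr_mono) auto
      then show "of_bool (emp n (\<lambda>t. (u t, y t)) = m1y f) * (2 * 2 powr (- (real n * MI_2_Y_given_1 f)))
          \<le> 2 * 2 powr (- (real n * \<rho>\<^sub>2))" by (auto simp: of_bool_def)
    qed
    also have "\<dots> = real (card ?F2) * (2 * 2 powr (- (real n * \<rho>\<^sub>2)))" by simp
    also have "\<dots> \<le> ?N * (2 * 2 powr (- (real n * \<rho>\<^sub>2)))"
    proof (rule mult_right_mono)
      have "card ?F2 \<le> card ?F" by (intro card_mono finF) auto
      then show "real (card ?F2) \<le> ?N" using cardF by linarith
    qed simp
    finally show ?thesis by (simp add: mult_ac)
  qed

  have e3: "(\<Sum>u'\<in>S. \<mu>\<^sub>1 u' * min 1 (real M\<^sub>2 * (\<Sum>v'\<in>T u'. \<mu>\<^sub>2 u' v' * of_bool (B u' v' y))))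
      \<le> 16 * ?N * 2 powr (- (real n * \<rho>\<^sub>1))"
    if u: "u \<in> S" and v: "v \<in> T u" and g: "G u v y" for u v y
  proof -
    let ?F1 = "{f \<in> ?F. \<rho>\<^sub>1 \<le> MI_1_Y f + pos_part (MI_2_Y_given_1 f - r\<^sub>2)}"
    have fin1: "finite ?F1" using finF by simp
    let ?b = "\<lambda>f :: ('a1, 'a2, 'y) jdist. 4 * 2 powr (- (real n * pos_part (MI_2_Y_given_1 f - r\<^sub>2)))"
    have min: "min 1 (real M\<^sub>2 * (\<Sum>v'\<in>T u'. \<mu>\<^sub>2 u' v' * of_bool (B u' v' y))) \<le>
        (\<Sum>f\<in>?F1. of_bool (emp n (\<lambda>t. (u' t, y t)) = m1y f) * ?b f)" if u': "u' \<in> S" for u'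
    proof -
      have "(\<Sum>v'\<in>T u'. \<mu>\<^sub>2 u' v' * of_bool (B u' v' y)) \<le>
        (\<Sum>f\<in>?F1. of_bool (emp n (\<lambda>t. (u' t, y t)) = m1y f) * (2 * 2 powr (- (real n * MI_2_Y_given_1 f))))"
      proof (rule sat[OF u'])
        fix v' assume v': "v' \<in> T u'" and b: "B u' v' y"
        have "\<rho>\<^sub>1 \<le> MI_1_Y (emp n (\<lambda>t. (u' t, v' t, y t))) +
            pos_part (MI_2_Y_given_1 (emp n (\<lambda>t. (u' t, v' t, y t))) - r\<^sub>2)"
          using v' b Gm(2)[OF g] by (intro h1 is_dist_emp[OF n]) (auto simp: emp_marginals T_def P12 B_def)
        then show "emp n (\<lambda>t. (u' t, v' t, y t)) \<in> ?F1" by auto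
      qed auto
      then have "min 1 (real M\<^sub>2 * (\<Sum>v'\<in>T u'. \<mu>\<^sub>2 u' v' * of_bool (B u' v' y))) \<le>
        min 1 (\<Sum>f\<in>?F1. real M\<^sub>2 * (of_bool (emp n (\<lambda>t. (u' t, y t)) = m1y f) * (2 * 2 powr (- (real n * MI_2_Y_given_1 f)))))"
        unfolding sum_distrib_left[symmetric] by (intro min.mono mult_left_mono) auto
      also have "\<dots> \<le> (\<Sum>f\<in>?F1. of_bool (emp n (\<lambda>t. (u' t, y t)) = m1y f) * ?b f)"
      proof (rule min_1_sum_le[OF fin1])
        fix f :: "('a1, 'a2, 'y) jdist"
        \<comment> \<open>Above \<open>r\<^sub>2\<close> the number of satellites is paid for out of
          the exponent; below it the positive part is 0 and the truncation at 1 gives the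
          bound.\<close>
        have "min 1 (real M\<^sub>2 * (2 * 2 powr (- (real n * MI_2_Y_given_1 f)))) \<le> ?b f"
        proof (cases "r\<^sub>2 \<le> MI_2_Y_given_1 f")
          case True
          have "real M\<^sub>2 * (2 * 2 powr (- (real n * MI_2_Y_given_1 f))) \<le>
              (2 * 2 powr (real n * r\<^sub>2)) * (2 * 2 powr (- (real n * MI_2_Y_given_1 f)))"
            by (intro mult_right_mono M2) auto
          also have "\<dots> = ?b f" using True by (simp add: pos_part_def powr_add[symmetric] algebra_simps)
          finally show ?thesis by simp
        next
          case False
          then show ?thesis by (simp add: pos_part_def)
        qed
        then show "min 1 (real M\<^sub>2 * (of_bool (emp n (\<lambda>t. (u' t, y t)) = m1y f) * (2 * 2 powr (- (real n * MI_2_Y_given_1 f)))))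
            \<le> of_bool (emp n (\<lambda>t. (u' t, y t)) = m1y f) * ?b f" by (auto simp: of_bool_def)
      qed simp
      finally show ?thesis .
    qed
    have "(\<Sum>u'\<in>S. \<mu>\<^sub>1 u' * min 1 (real M\<^sub>2 * (\<Sum>v'\<in>T u'. \<mu>\<^sub>2 u' v' * of_bool (B u' v' y)))) \<le>
        (\<Sum>u'\<in>S. (4 * iid p1 n u') * (\<Sum>f\<in>?F1. of_bool (emp n (\<lambda>t. (u' t, y t)) = m1y f) * ?b f))"
    proof (rule sum_mono)
      fix u' assume u': "u' \<in> S"
      have "\<mu>\<^sub>1 u' * min 1 (real M\<^sub>2 * (\<Sum>v'\<in>T u'. \<mu>\<^sub>2 u' v' * of_bool (B u' v' y))) \<le>
          \<mu>\<^sub>1 u' * (\<Sum>f\<in>?F1. of_bool (emp n (\<lambda>t. (u' t, y t)) = m1y f) * ?b f)"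
        by (intro mult_left_mono min u' \<mu>10)
      also have "\<dots> \<le> (4 * iid p1 n u') * (\<Sum>f\<in>?F1. of_bool (emp n (\<lambda>t. (u' t, y t)) = m1y f) * ?b f)"
        by (intro mult_right_mono \<mu>1_le sum_nonneg) simp
      finally show "\<mu>\<^sub>1 u' * min 1 (real M\<^sub>2 * (\<Sum>v'\<in>T u'. \<mu>\<^sub>2 u' v' * of_bool (B u' v' y))) \<le>
          (4 * iid p1 n u') * (\<Sum>f\<in>?F1. of_bool (emp n (\<lambda>t. (u' t, y t)) = m1y f) * ?b f)" .
    qed
    also have "\<dots> \<le> (\<Sum>u'\<in>seqs n. (4 * iid p1 n u') * (\<Sum>f\<in>?F1. of_bool (emp n (\<lambda>t. (u' t, y t)) = m1y f) * ?b f))"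
      by (intro sum_mono2 finite_seqs Ssub mult_nonneg_nonneg sum_nonneg) (auto simp: p1n0)
    also have "\<dots> = (\<Sum>f\<in>?F1. 4 * ?b f * (\<Sum>u'\<in>seqs n. iid p1 n u' * of_bool (emp n (\<lambda>t. (u' t, y t)) = m1y f)))"
      unfolding sum_distrib_left by (subst sum.swap) (simp only: mult_ac)
    also have "\<dots> \<le> (\<Sum>f\<in>?F1. 16 * 2 powr (- (real n * \<rho>\<^sub>1)))"
    proof (rule sum_mono)
      fix f assume f: "f \<in> ?F1"
      have "4 * ?b f * (\<Sum>u'\<in>seqs n. iid p1 n u' * of_bool (emp n (\<lambda>t. (u' t, y t)) = m1y f)) \<le>
          4 * ?b f * 2 powr (- (real n * MI_1_Y f))"
        by (intro mult_left_mono cloud_type_prob_le p1 n) simp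
      also have "\<dots> = 16 * 2 powr (- (real n * (MI_1_Y f + pos_part (MI_2_Y_given_1 f - r\<^sub>2))))"
        by (simp add: powr_add[symmetric] algebra_simps)
      also have "\<dots> \<le> 16 * 2 powr (- (real n * \<rho>\<^sub>1))"
        using f n by (intro mult_left_mono powr_mono) auto
      finally show "4 * ?b f * (\<Sum>u'\<in>seqs n. iid p1 n u' * of_bool (emp n (\<lambda>t. (u' t, y t)) = m1y f))
          \<le> 16 * 2 powr (- (real n * \<rho>\<^sub>1))" .
    qed
    also have "\<dots> = real (card ?F1) * (16 * 2 powr (- (real n * \<rho>\<^sub>1)))" by simp
    also have "\<dots> \<le> ?N * (16 * 2 powr (- (real n * \<rho>\<^sub>1)))"
    proof (rule mult_right_mono)
      have "card ?F1 \<le> card ?F" by (intro card_mono finF) auto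
      then show "real (card ?F1) \<le> ?N" using cardF by linarith
    qed simp
    finally show ?thesis by (simp add: mult_ac)
  qed

  have sum1: "(\<Sum>u\<in>S. \<mu>\<^sub>1 u) = 1"
    using Z by (simp add: \<mu>\<^sub>1_def Z_def flip: sum_divide_distrib)
  have sum2: "(\<Sum>v\<in>T u. \<mu>\<^sub>2 u v) = 1" if "u \<in> S" for u
    using that by (simp add: \<mu>\<^sub>2_def S_def flip: sum_divide_distrib \<kappa>_def)
  obtain x\<^sub>1 x\<^sub>2 where x: "(\<Sum>m<M. \<Sum>y\<in>seqs n. K (x\<^sub>1 (m div M\<^sub>2)) (x\<^sub>2 (m div M\<^sub>2) (m mod M\<^sub>2)) y *
        of_bool (\<not> G (x\<^sub>1 (m div M\<^sub>2)) (x\<^sub>2 (m div M\<^sub>2) (m mod M\<^sub>2)) y \<or>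
          (\<exists>m'<M. m' \<noteq> m \<and> B (x\<^sub>1 (m' div M\<^sub>2)) (x\<^sub>2 (m' div M\<^sub>2) (m' mod M\<^sub>2)) y))) / real M
      \<le> 8 * (real CARD('a1 \<times> 'a2 \<times> 'y))\<^sup>2 / (\<eta>\<^sup>2 * real n)
        + (real M\<^sub>2 - 1) * (2 * ?N * 2 powr (- (real n * \<rho>\<^sub>2)))
        + (real M\<^sub>1 - 1) * (16 * ?N * 2 powr (- (real n * \<rho>\<^sub>1)))"
    by (rule superposition_random_coding[OF finS finT finite_seqs \<mu>10 \<mu>20 K0 sum1 sum2 K1 e1 e2 e3 _ _ M])
      auto
  define C where "C m t = \<phi> (x\<^sub>1 (m div M\<^sub>2) t) (x\<^sub>2 (m div M\<^sub>2) (m mod M\<^sub>2) t)" for m t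
  have "avg_error_prob W q n M C \<le> (\<Sum>m<M. \<Sum>y\<in>seqs n. K (x\<^sub>1 (m div M\<^sub>2)) (x\<^sub>2 (m div M\<^sub>2) (m mod M\<^sub>2)) y *
        of_bool (\<not> G (x\<^sub>1 (m div M\<^sub>2)) (x\<^sub>2 (m div M\<^sub>2) (m mod M\<^sub>2)) y \<or>
          (\<exists>m'<M. m' \<noteq> m \<and> B (x\<^sub>1 (m' div M\<^sub>2)) (x\<^sub>2 (m' div M\<^sub>2) (m' mod M\<^sub>2)) y))) / real M"
    unfolding avg_error_prob_def times_divide_eq_left mult_1
  proof (intro divide_right_mono sum_mono mult_mono)
    fix m y assume "m \<in> {..<M}"
    show "(\<Prod>t<n. W (C m t) (y t)) \<le> K (x\<^sub>1 (m div M\<^sub>2)) (x\<^sub>2 (m div M\<^sub>2) (m mod M\<^sub>2)) y"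
      by (simp add: K_def C_def)
    have em: "expect_metric (emp n (\<lambda>t. (x\<^sub>1 (m div M\<^sub>2) t, x\<^sub>2 (m div M\<^sub>2) (m mod M\<^sub>2) t, y t))) qt =
        (\<Sum>t<n. q (C m t) (y t)) / real n" for m
      by (simp add: expect_metric_emp qt_def induced_metric_def C_def)
    show "(if decodes_correctly q n M C m y then 0 else 1) \<le>
        (of_bool (\<not> G (x\<^sub>1 (m div M\<^sub>2)) (x\<^sub>2 (m div M\<^sub>2) (m mod M\<^sub>2)) y \<or>
          (\<exists>m'<M. m' \<noteq> m \<and> B (x\<^sub>1 (m' div M\<^sub>2)) (x\<^sub>2 (m' div M\<^sub>2) (m' mod M\<^sub>2)) y)) :: real)"
    proof (cases "decodes_correctly q n M C m y \<or> \<not> G (x\<^sub>1 (m div M\<^sub>2)) (x\<^sub>2 (m div M\<^sub>2) (m mod M\<^sub>2)) y")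
      case True
      then show ?thesis by auto
    next
      case False
      \<comment> \<open>Ties are decoding errors, so the competitor's metric is only known to be at
        least as large; this matches the weak inequality in \<open>B\<close>.\<close>
      then obtain m' where m': "m' < M" "m' \<noteq> m"
        and le: "(\<Sum>t<n. q (C m t) (y t)) \<le> (\<Sum>t<n. q (C m' t) (y t))"
        by (auto simp: decodes_correctly_def not_less)
      let ?f = "emp n (\<lambda>t. (x\<^sub>1 (m div M\<^sub>2) t, x\<^sub>2 (m div M\<^sub>2) (m mod M\<^sub>2) t, y t))"
      have "l1 ?f P \<le> \<eta>" using False by (simp add: G_def)
      then have "metric_norm qt * l1 ?f P \<le> metric_norm qt * \<eta>"
        by (rule mult_left_mono[OF _ metric_norm_nonneg])
      then have "expect_metric P qt - metric_norm qt * \<eta> \<le> expect_metric ?f qt"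
        using expect_metric_diff_le[of P qt ?f] by linarith
      also have "\<dots> \<le> expect_metric (emp n (\<lambda>t. (x\<^sub>1 (m' div M\<^sub>2) t, x\<^sub>2 (m' div M\<^sub>2) (m' mod M\<^sub>2) t, y t))) qt"
        unfolding em using le by (intro divide_right_mono) auto
      finally have "B (x\<^sub>1 (m' div M\<^sub>2)) (x\<^sub>2 (m' div M\<^sub>2) (m' mod M\<^sub>2)) y" by (simp add: B_def)
      then show ?thesis using m' by auto
    qed
  qed (auto simp: K0)
  then show ?thesis using x by (intro exI[of _ C]) linarith
qed

section \<open>Achievability\<close>

lemma num_msgs_pos: "0 < num_msgs R n"
  by (simp add: num_msgs_def)

lemma num_msgs_ge: "2 powr (real n * R) \<le> real (num_msgs R n)"
  unfolding num_msgs_def by linarith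

lemma num_msgs_less: "real (num_msgs R n) < 2 powr (real n * R) + 1"
proof -
  have "0 \<le> 2 powr (real n * R)" by simp
  then show ?thesis unfolding num_msgs_def by linarith
qed

lemma num_msgs_0 [simp]: "num_msgs 0 n = 1"
  by (simp add: num_msgs_def)

text \<open>Rounding up both factors leaves at least as many index pairs as messages, so every
  message gets a cloud and a satellite.\<close>

lemma num_msgs_add_le: "num_msgs (r + s) n \<le> num_msgs r n * num_msgs s n"
proof -
  have "2 powr (real n * (r + s)) = 2 powr (real n * r) * 2 powr (real n * s)"
    by (simp add: distrib_left powr_add)
  also have "\<dots> \<le> real (num_msgs r n) * real (num_msgs s n)"
    by (intro mult_mono num_msgs_ge) auto
  finally have "2 powr (real n * (r + s)) \<le> real (num_msgs r n * num_msgs s n)" by simp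
  then show ?thesis unfolding num_msgs_def[of "r + s"] by linarith
qed

lemma poly_exp_tendsto_0:
  assumes "0 < d"
  shows "(\<lambda>n. real ((n + 1) ^ k) * 2 powr (- (real n * d))) \<longlonglongrightarrow> 0"
proof -
  have "(\<lambda>n. (real n + 1) powr real k * 2 powr (- (real n * d))) \<longlonglongrightarrow> 0"
    using assms by real_asymp
  then show ?thesis by (simp add: powr_realpow add.commute)
qed

text \<open>At \<open>r = 0\<close> the first factor is exactly 0, so \<open>\<rho>\<close> may then
  be negative; this occurs when a rate function leaves no positive exponent.\<close>

lemma num_msgs_exp_tendsto_0:
  assumes "r = 0 \<or> r < \<rho>"
  shows "(\<lambda>n. (real (num_msgs r n) - 1) * (c * real ((n + 1) ^ k) * 2 powr (- (real n * \<rho>)))) \<longlonglongrightarrow> 0"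
proof (cases "r = 0")
  case False
  then have d: "0 < \<rho> - r" using assms by simp
  show ?thesis
  proof (rule Lim_null_comparison)
    show "\<forall>\<^sub>F n in sequentially. norm ((real (num_msgs r n) - 1) * (c * real ((n + 1) ^ k) * 2 powr (- (real n * \<rho>))))
        \<le> \<bar>c\<bar> * (real ((n + 1) ^ k) * 2 powr (- (real n * (\<rho> - r))))"
    proof (intro always_eventually allI)
      fix n
      have "\<bar>real (num_msgs r n) - 1\<bar> \<le> 2 powr (real n * r)"
        using num_msgs_less[of r n] num_msgs_pos[of r n] by linarith
      then have "norm ((real (num_msgs r n) - 1) * (c * real ((n + 1) ^ k) * 2 powr (- (real n * \<rho>)))) \<le>
          2 powr (real n * r) * (\<bar>c\<bar> * real ((n + 1) ^ k) * 2 powr (- (real n * \<rho>)))"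
        unfolding real_norm_def abs_mult by (intro mult_mono) auto
      also have "\<dots> = \<bar>c\<bar> * (real ((n + 1) ^ k) * (2 powr (real n * r) * 2 powr (- (real n * \<rho>))))"
        by (simp only: mult_ac)
      also have "2 powr (real n * r) * 2 powr (- (real n * \<rho>)) = 2 powr (- (real n * (\<rho> - r)))"
        by (simp add: powr_add[symmetric] algebra_simps)
      finally show "norm ((real (num_msgs r n) - 1) * (c * real ((n + 1) ^ k) * 2 powr (- (real n * \<rho>))))
        \<le> \<bar>c\<bar> * (real ((n + 1) ^ k) * 2 powr (- (real n * (\<rho> - r))))" .
    qed
    show "(\<lambda>n. \<bar>c\<bar> * (real ((n + 1) ^ k) * 2 powr (- (real n * (\<rho> - r))))) \<longlonglongrightarrow> 0"
      by (rule tendsto_mult_right_zero[OF poly_exp_tendsto_0[OF d]])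
  qed
qed simp

lemma avg_error_prob_nonneg:
  assumes "is_channel W" shows "0 \<le> avg_error_prob W q n M C"
  using assms unfolding avg_error_prob_def
  by (intro mult_nonneg_nonneg sum_nonneg prod_nonneg) (auto simp: is_channel_def is_dist_def)

lemma achievableI:
  assumes W: "is_channel W" and b: "b \<longlonglongrightarrow> 0"
    and ev: "\<forall>\<^sub>F n in sequentially. \<exists>C. avg_error_prob W q n (num_msgs R n) C \<le> b n"
  shows "achievable W q R"
proof -
  define C where "C n = (SOME C. avg_error_prob W q n (num_msgs R n) C \<le> b n)" for n
  have "\<forall>\<^sub>F n in sequentially. avg_error_prob W q n (num_msgs R n) (C n) \<le> b n"
    using ev
  proof eventually_elim
    case (elim n)
    then show ?case unfolding C_def by (rule someI_ex)
  qed
  then have "(\<lambda>n. avg_error_prob W q n (num_msgs R n) (C n)) \<longlonglongrightarrow> 0"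
    by (intro tendsto_sandwich[OF _ _ tendsto_const b]) (auto simp: avg_error_prob_nonneg[OF W])
  then show ?thesis unfolding achievable_def by blast
qed

text \<open>Scaling both rates by the same \<open>l < 1\<close> keeps each at 0 or puts it strictly
  below its bound. The bound for the first rate survives because \<open>R1''\<close> can only grow
  when the satellite rate is lowered.\<close>

lemma achievable_superposition:
  assumes W: "is_channel W" and PX: "is_dist PX"
    and R: "(R1, R2) \<in> R_sup_cog (induced_dist PX W \<phi>) (induced_metric q \<phi>)"
    and pos: "0 < R" "R < R1 + R2"
  shows "achievable W q R"
proof -
  let ?P = "induced_dist PX W \<phi>" and ?qt = "induced_metric q \<phi>"
  have P: "is_dist ?P" by (rule is_dist_induced[OF W PX])
  have R1: "0 \<le> R1" "R1 \<le> R1'' ?P ?qt R2" and R2: "0 \<le> R2" "R2 \<le> R2' ?P ?qt"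
    using R by (auto simp: R_sup_cog_def)
  define l where "l = R / (R1 + R2)"
  have l: "0 < l" "l < 1" using pos by (auto simp: l_def)
  define r1 r2 where "r1 = l * R1" and "r2 = l * R2"
  have "r1 + r2 = l * (R1 + R2)" by (simp add: r1_def r2_def distrib_left)
  then have r: "r1 + r2 = R" using pos by (simp add: l_def)
  have scale: "x = 0 \<or> l * x < x" if "0 \<le> x" for x
    using that l mult_strict_right_mono[of l 1 x] by (cases "x = 0") auto
  have r1: "r1 = 0 \<or> r1 < R1" and r2: "r2 = 0 \<or> r2 < R2" and r2_le: "r2 \<le> R2"
    using scale[OF R1(1)] scale[OF R2(1)] by (auto simp: r1_def r2_def)
  have "R1'' ?P ?qt R2 \<le> R1'' ?P ?qt r2"
    unfolding R1''_def[of _ _ r2]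
  proof (rule cINF_greatest)
    have "?P \<in> setL0 ?P ?qt" using P by (simp add: mem_setL)
    then show "setL0 ?P ?qt \<noteq> {}" by blast
    fix f assume f: "f \<in> setL0 ?P ?qt"
    have "R1'' ?P ?qt R2 \<le> MI_1_Y f + pos_part (MI_2_Y_given_1 f - R2)"
      unfolding R1''_def using f
      by (intro cINF_dist continuous_on_add continuous_on_MI continuous_on_pos_part continuous_on_diff continuous_on_const)
        (auto simp: mem_setL)
    also have "\<dots> \<le> MI_1_Y f + pos_part (MI_2_Y_given_1 f - r2)" using r2_le by (simp add: pos_part_def)
    finally show "R1'' ?P ?qt R2 \<le> MI_1_Y f + pos_part (MI_2_Y_given_1 f - r2)" .
  qed
  then have R1: "R1 \<le> R1'' ?P ?qt r2" using R1 by simp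
  \<comment> \<open>For \<open>r1 > 0\<close> any value strictly between \<open>r1\<close> and
    \<open>R1\<close> serves; for \<open>r1 = 0\<close> anything below the rate function will
    do.\<close>
  obtain \<rho>1 where \<rho>1: "\<rho>1 < R1'' ?P ?qt r2" "r1 = 0 \<or> r1 < \<rho>1"
    using r1 R1 dense[of r1 R1] by (metis lt_ex order_less_le_trans)
  obtain \<rho>2 where \<rho>2: "\<rho>2 < R2' ?P ?qt" "r2 = 0 \<or> r2 < \<rho>2"
    using r2 R2(2) dense[of r2 R2] by (metis lt_ex order_less_le_trans)
  obtain d1 where d1: "0 < d1" "\<And>f. is_dist f \<Longrightarrow> l1 (m12 f) (m12 ?P) \<le> d1 \<Longrightarrow>
      l1 (my f) (my ?P) \<le> d1 \<Longrightarrow> expect_metric ?P ?qt - d1 \<le> expect_metric f ?qt \<Longrightarrow>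
      \<rho>1 < MI_1_Y f + pos_part (MI_2_Y_given_1 f - r2)"
    using R1''_relax[OF P \<rho>1(1)] by blast
  obtain d2 where d2: "0 < d2" "\<And>f. is_dist f \<Longrightarrow> l1 (m12 f) (m12 ?P) \<le> d2 \<Longrightarrow>
      l1 (m1y f) (m1y ?P) \<le> d2 \<Longrightarrow> expect_metric ?P ?qt - d2 \<le> expect_metric f ?qt \<Longrightarrow>
      \<rho>2 < MI_2_Y_given_1 f"
    using R2'_relax[OF P \<rho>2(1)] by blast
  \<comment> \<open>The denominator keeps both \<open>\<eta>\<close> and
    \<open>metric_norm ?qt * \<eta>\<close> below \<open>d1\<close> and \<open>d2\<close>.\<close>
  define \<eta> where "\<eta> = min d1 d2 / (1 + metric_norm ?qt)"
  have c: "0 \<le> metric_norm ?qt" by (rule metric_norm_nonneg)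
  have \<eta>: "0 < \<eta>" using d1 d2 c by (simp add: \<eta>_def)
  have "(1 + metric_norm ?qt) * \<eta> = min d1 d2" using c by (simp add: \<eta>_def)
  then have "\<eta> + metric_norm ?qt * \<eta> = min d1 d2" by (simp add: distrib_right)
  moreover have "0 \<le> metric_norm ?qt * \<eta>" using c \<eta> by simp
  ultimately have \<eta>_le: "\<eta> \<le> d1" "\<eta> \<le> d2" "metric_norm ?qt * \<eta> \<le> d1" "metric_norm ?qt * \<eta> \<le> d2"
    using \<eta> by linarith+
  let ?k = "CARD('c \<times> 'd \<times> 'b)"
  define b where "b n = 8 * (real ?k)\<^sup>2 / (\<eta>\<^sup>2 * real n)
      + (real (num_msgs r2 n) - 1) * (2 * real ((n + 1) ^ ?k) * 2 powr (- (real n * \<rho>2)))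
      + (real (num_msgs r1 n) - 1) * (16 * real ((n + 1) ^ ?k) * 2 powr (- (real n * \<rho>1)))" for n
  show ?thesis
  proof (rule achievableI[OF W])
    have "(\<lambda>n. 8 * (real ?k)\<^sup>2 / (\<eta>\<^sup>2 * real n)) \<longlonglongrightarrow> 0"
      using \<eta> by real_asymp
    then show "b \<longlonglongrightarrow> 0"
      unfolding b_def by (intro tendsto_add_zero num_msgs_exp_tendsto_0 \<rho>1 \<rho>2)
    have "filterlim (\<lambda>n. \<eta>\<^sup>2 * real n) at_top sequentially" using \<eta> by real_asymp
    then have "\<forall>\<^sub>F n in sequentially. 4 * (real CARD('c \<times> 'd))\<^sup>2 \<le> \<eta>\<^sup>2 * real n"
      by (simp only: filterlim_at_top)
    then show "\<forall>\<^sub>F n in sequentially. \<exists>C. avg_error_prob W q n (num_msgs R n) C \<le> b n"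
      using eventually_gt_at_top[of 0]
    proof eventually_elim
      case (elim n)
      show ?case unfolding b_def
      proof (rule superposition_error_bound[OF W PX elim(2) \<eta> elim(1)])
        fix f :: "('c, 'd, 'b) jdist"
        assume f: "is_dist f" "l1 (m12 f) (m12 ?P) \<le> \<eta>"
          "expect_metric ?P ?qt - metric_norm ?qt * \<eta> \<le> expect_metric f ?qt"
        show "\<rho>2 \<le> MI_2_Y_given_1 f" if "l1 (m1y f) (m1y ?P) \<le> \<eta>"
          using that f \<eta>_le by (intro less_imp_le[OF d2(2)]) linarith+
        show "\<rho>1 \<le> MI_1_Y f + pos_part (MI_2_Y_given_1 f - r2)" if "l1 (my f) (my ?P) \<le> \<eta>"
          using that f \<eta>_le by (intro less_imp_le[OF d1(2)]) linarith+
      next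
        \<comment> \<open>This absorbs the rounding in \<open>num_msgs\<close> into the factor
          2.\<close>
        have "1 \<le> 2 powr (real n * r2)" using R2(1) l by (intro ge_one_powr_ge_zero) (auto simp: r2_def)
        then show "real (num_msgs r2 n) \<le> 2 * 2 powr (real n * r2)" using num_msgs_less[of r2 n] by linarith
        show "num_msgs R n \<le> num_msgs r1 n * num_msgs r2 n" using num_msgs_add_le[of r1 r2 n] r by simp
      qed (rule num_msgs_pos)
    qed
  qed
qed

lemma achievable_0: "achievable W q 0"
proof -
  have "avg_error_prob W q n 1 C = 0" for n C
    by (auto simp: avg_error_prob_def decodes_correctly_def)
  then show ?thesis by (simp add: achievable_def)
qed

lemma R_sup_cog_le_capacity:
  assumes W: "is_channel W" and PX: "is_dist PX"
    and R: "(R1, R2) \<in> R_sup_cog (induced_dist PX W \<phi>) (induced_metric q \<phi>)"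
  shows "ereal (R1 + R2) \<le> mismatch_capacity W q"
proof (rule ccontr)
  have le: "ereal R \<le> mismatch_capacity W q" if "achievable W q R" for R
    unfolding mismatch_capacity_def using that by (intro Sup_upper) auto
  assume "\<not> ?thesis"
  then have "mismatch_capacity W q < ereal (R1 + R2)" by simp
  then obtain R where R': "mismatch_capacity W q < ereal R" "R < R1 + R2"
    using ereal_dense2 by (metis less_ereal.simps(1))
  \<comment> \<open>A single message is never confused, so the capacity is nonnegative and the
    intermediate rate \<open>R\<close> is positive, as \<open>achievable_superposition\<close>
    requires.\<close>
  moreover have "ereal 0 \<le> mismatch_capacity W q" by (rule le[OF achievable_0])
  ultimately have "ereal 0 < ereal R" by order
  then have "achievable W q R" using R' by (intro achievable_superposition[OF W PX R]) auto
  then show False using le[of R] R' by simp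
qed

theorem theorem7:
  fixes W :: "'x::finite \<Rightarrow> 'y::finite \<Rightarrow> real"
    and q :: "'x \<Rightarrow> 'y \<Rightarrow> real"
    and PX :: "'a1::finite \<times> 'a2::finite \<Rightarrow> real"
    and \<phi> :: "'a1 \<Rightarrow> 'a2 \<Rightarrow> 'x"
  assumes "is_channel W"
    and "is_dist PX"
  shows "Sup ((\<lambda>(R1, R2). ereal (R1 + R2)) `
           R_cog (induced_dist PX W \<phi>) (induced_metric q \<phi>)) \<le> mismatch_capacity W q"
proof -
  let ?P = "induced_dist PX W \<phi>" and ?qt = "induced_metric q \<phi>"
  define PX' where "PX' z = PX (prod.swap z)" for z
  define \<phi>' where "\<phi>' b a = \<phi> a b" for b a
  have PX': "is_dist PX'"
    using assms(2) sum_reindex_bij[of prod.swap PX] by (simp add: is_dist_def PX'_def)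
  \<comment> \<open>The exchanged problem is induced by the same \<open>W\<close> and
    \<open>q\<close>, with \<open>\<phi>'\<close> in place of \<open>\<phi>\<close>, so both
    superposition regions bound the same capacity.\<close>
  have sw: "swap12 ?P = induced_dist PX' W \<phi>'" "(\<lambda>b a y. ?qt a b y) = induced_metric q \<phi>'"
    by (auto simp: swap12_def induced_dist_def induced_metric_def PX'_def \<phi>'_def)
  have P: "is_dist ?P" by (rule is_dist_induced[OF assms])
  have "ereal (R1 + R2) \<le> mismatch_capacity W q" if R: "(R1, R2) \<in> R_cog ?P ?qt" for R1 R2
  proof -
    obtain S1 S2 where S: "S1 + S2 = R1 + R2"
      "(S1, S2) \<in> R_sup_cog ?P ?qt \<or> (S1, S2) \<in> R_sup_cog (swap12 ?P) (\<lambda>b a y. ?qt a b y)"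
      using R R_bin_cog_sum[OF P, of R1 R2 ?qt] by (auto simp: R_cog_def)
    then show ?thesis
      using R_sup_cog_le_capacity[OF assms, of S1 S2 \<phi> q] R_sup_cog_le_capacity[OF assms(1) PX', of S1 S2 \<phi>' q]
      unfolding sw by auto
  qed
  then show ?thesis by (intro Sup_least) auto
qed

end
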